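(* Let $\mu_\omega$ be the random Moran measures, and $G,G'$ the functions on $[0,\infty)$, described in the context. Let $\psi\ge 0$. (i) Suppose $G(\psi)<\psi$. Then there is a set $\Gamma_\psi\subseteq\Omega$ of full measure such that $\overline{\dim}_\Phi\mu_\omega\le\psi$ for all large dimension functions $\Phi$ and all $\omega\in\Gamma_\psi$. (ii) Suppose $G(\psi)\ge\psi$. Then there is a set $\Gamma_\psi\subseteq\Omega$ of full measure such that $\overline{\dim}_\Phi\mu_\omega\ge\psi$ for all large dimension functions $\Phi$ and all $\omega\in\Gamma_\psi$. (iii) Suppose $G'(\psi)>\psi$. Then there is a set $\Gamma_\psi\subseteq\Omega$ of full measure such that $\underline{\dim}_\Phi\mu_\omega\ge\psi$ for all large dimension functions $\Phi$ and all $\omega\in\Gamma_\psi$. (iv) Suppose $G'(\psi)\le\psi$. Then there is a set $\Gamma_\psi\subseteq\Omega$ of full measure such that $\underline{\dim}_\Phi\mu_\omega\le\psi$ for all large dimension functions $\Phi$ and all $\omega\in\Gamma_\psi$.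
   Context: **Random Moran sets and measures.** Let $(\Omega,\mathcal P)$ be a probability space and fix $0<2A\le B<1$. Let $(a_n(\omega),b_n(\omega),p_n(\omega))$, $n\ge1$, be independent, identically distributed random vectors with values in $\{(x,y,z)\in[0,1]^3: A\le\min(x,y)<x+y\le B\}$ (for a fixed $n$ the three coordinates may be dependent). Assume $\mathbb E(p_n^{-t})<\infty$ and $\mathbb E((1-p_n)^{-t})<\infty$ for some $t>0$ (so almost surely $0<p_n<1$ for all $n$). The Moran interval of step $0$ is $[0,1]$. Each Moran interval $I$ of step $n-1$ has two children, which are Moran intervals of step $n$: the left child is the closed subinterval of $I$ with the same left endpoint and length $a_n(\omega)|I|$, and the right child is the closed subinterval of $I$ with the same right endpoint and length $b_n(\omega)|I|$. Here $|I|$ is the length of $I$. Let $\mathcal C_\omega^{(n)}$ be the union of the $2^n$ Moran intervals of step $n$ and $\mathcal C_\omega=\bigcap_n\mathcal C_\omega^{(n)}$. The random measure $\mu_\omega$ is the Borel probability measure on $\mathcal C_\omega$ with $\mu_\omega([0,1])=1$ such that for every Moran interval $I_N$ of step $N$, its left child has measure $p_{N+1}(\omega)\mu_\omega(I_N)$ and its right child has measure $(1-p_{N+1}(\omega))\mu_\omega(I_N)$. **Dimensions.** A dimension function is a map $\Phi:(0,1)\to[0,\infty)$ such that $\Psi(t)=t^{1+\Phi(t)}$ decreases to $0$ as $t$ decreases to $0$ and is doubling: there are $C_1,C_2>0$ with $\Psi(2t)\le C_1\Psi(t)$ for all $0<t<C_2$. It is large if, for $t$ near $0$, $\Phi(t)=H(t)\frac{\log|\log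 t|}{|\log t|}$ where $H(t)\to\infty$ as $t\to0$. For a measure $\mu$, with $B(x,r)$ the open ball of centre $x$ and radius $r$, $\overline{\dim}_\Phi\mu$ is the infimum of those $d$ for which there exist $C_1,C_2>0$ such that $\frac{\mu(B(x,R))}{\mu(B(x,r))}\le C_2\left(\frac Rr\right)^d$ for all $x\in\operatorname{supp}\mu$ and all $0<r<R^{1+\Phi(R)}\le R\le C_1$; and $\underline{\dim}_\Phi\mu$ is the supremum of those $d$ for which there exist $C_1,C_2>0$ such that $\frac{\mu(B(x,R))}{\mu(B(x,r))}\ge C_2\left(\frac Rr\right)^d$ for all $x\in\operatorname{supp}\mu$ and all $0<r<R^{1+\Phi(R)}\le R\le C_1$. **The functions $G,G'$.** For $\theta\ge0$ put $c_n(\theta)=\frac{a_n^\theta}{a_n^\theta+b_n^\theta}$. Define random variables $Y_n(\theta)=\log p_n$ and $Z_n(\theta)=\log a_n$ if $p_n\le c_n(\theta)$, and $Y_n(\theta)=\log(1-p_n)$ and $Z_n(\theta)=\log b_n$ if $p_n>c_n(\theta)$. Define $Y_n'(\theta)=\log p_n$, $Z_n'(\theta)=\log a_n$ if $p_n>c_n(\theta)$, and $Y_n'(\theta)=\log(1-p_n)$, $Z_n'(\theta)=\log b_n$ if $p_n\le c_n(\theta)$. Put $G(\theta)=\frac{\mathbb E(Y_1(\theta))}{\mathbb E(Z_1(\theta))}$ and $G'(\theta)=\frac{\mathbb E(Y_1'(\theta))}{\mathbb E(Z_1'(\theta))}$ ($G'$ is not a derivative). *)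

theory Defs
  imports "HOL-Probability.Probability"
begin

text \<open>
  Moran intervals are represented by their pairs of endpoints. All sequences are indexed from 1:
  passing from step \<open>n\<close> to step \<open>n + 1\<close> uses the entry with index \<open>n + 1\<close>, and index \<open>0\<close> is
  never used.
\<close>

definition left_child :: "real \<Rightarrow> real \<times> real \<Rightarrow> real \<times> real" where
  "left_child c = (\<lambda>(l, r). (l, l + c * (r - l)))"

definition right_child :: "real \<Rightarrow> real \<times> real \<Rightarrow> real \<times> real" where
  "right_child c = (\<lambda>(l, r). (r - c * (r - l), r))"

primrec moran_intervals :: "(nat \<Rightarrow> real) \<Rightarrow> (nat \<Rightarrow> real) \<Rightarrow> nat \<Rightarrow> (real \<times> real) set" where
  "moran_intervals a b 0 = {(0, 1)}"
| "moran_intervals a b (Suc n) =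
     left_child (a (Suc n)) ` moran_intervals a b n \<union>
     right_child (b (Suc n)) ` moran_intervals a b n"

definition segment :: "real \<times> real \<Rightarrow> real set" where
  "segment I = {fst I..snd I}"

definition moran_set :: "(nat \<Rightarrow> real) \<Rightarrow> (nat \<Rightarrow> real) \<Rightarrow> real set" where
  "moran_set a b = (\<Inter>n. \<Union>I\<in>moran_intervals a b n. segment I)"

text \<open>
  A measure on the Moran set is regarded as a Borel measure on the real line that is concentrated
  on the Moran set.
\<close>

definition is_moran_measure ::
    "(nat \<Rightarrow> real) \<Rightarrow> (nat \<Rightarrow> real) \<Rightarrow> (nat \<Rightarrow> real) \<Rightarrow> real measure \<Rightarrow> bool" where
  "is_moran_measure a b p \<mu> \<longleftrightarrow>
     sets \<mu> = sets borel \<and> prob_space \<mu> \<and>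
     measure \<mu> (moran_set a b) = 1 \<and> measure \<mu> {0..1} = 1 \<and>
     (\<forall>N. \<forall>I\<in>moran_intervals a b N.
        measure \<mu> (segment (left_child (a (Suc N)) I)) = p (Suc N) * measure \<mu> (segment I) \<and>
        measure \<mu> (segment (right_child (b (Suc N)) I)) = (1 - p (Suc N)) * measure \<mu> (segment I))"

text \<open>
  Dimension functions have domain \<open>(0, 1)\<close>; they are total functions here, and their values
  outside \<open>(0, 1)\<close> are irrelevant below.
\<close>

definition dimension_function :: "(real \<Rightarrow> real) \<Rightarrow> bool" where
  "dimension_function \<Phi> \<longleftrightarrow>
     (\<forall>t\<in>{0<..<1}. 0 \<le> \<Phi> t) \<and>
     mono_on {0<..<1} (\<lambda>t. t powr (1 + \<Phi> t)) \<and>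
     ((\<lambda>t. t powr (1 + \<Phi> t)) \<longlongrightarrow> 0) (at_right 0) \<and>
     (\<exists>C\<^sub>1>0. \<exists>C\<^sub>2>0. \<forall>t. 0 < t \<and> t < C\<^sub>2 \<and> 2 * t < 1 \<longrightarrow>
        (2 * t) powr (1 + \<Phi> (2 * t)) \<le> C\<^sub>1 * t powr (1 + \<Phi> t))"

definition large_dimension_function :: "(real \<Rightarrow> real) \<Rightarrow> bool" where
  "large_dimension_function \<Phi> \<longleftrightarrow>
     dimension_function \<Phi> \<and>
     (\<exists>H. filterlim H at_top (at_right 0) \<and>
        (\<forall>\<^sub>F t in at_right 0. \<Phi> t = H t * (ln \<bar>ln t\<bar> / \<bar>ln t\<bar>)))"

definition measure_supp :: "'a::topological_space measure \<Rightarrow> 'a set" where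
  "measure_supp \<mu> = {x. \<forall>U. open U \<and> x \<in> U \<longrightarrow> emeasure \<mu> U > 0}"

text \<open>
  The dimensions are extended reals, so that the infimum over an empty set of exponents is \<open>\<infinity>\<close>.
\<close>

definition upper_dim :: "(real \<Rightarrow> real) \<Rightarrow> 'a::metric_space measure \<Rightarrow> ereal" where
  "upper_dim \<Phi> \<mu> = Inf {ereal d | d :: real. \<exists>C\<^sub>1>0. \<exists>C\<^sub>2>0. \<forall>x\<in>measure_supp \<mu>. \<forall>r. \<forall>R\<in>{0<..<1}.
     0 < r \<and> r < R powr (1 + \<Phi> R) \<and> R powr (1 + \<Phi> R) \<le> R \<and> R \<le> C\<^sub>1 \<longrightarrow>
       measure \<mu> (ball x R) / measure \<mu> (ball x r) \<le> C\<^sub>2 * (R / r) powr d}"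

definition lower_dim :: "(real \<Rightarrow> real) \<Rightarrow> 'a::metric_space measure \<Rightarrow> ereal" where
  "lower_dim \<Phi> \<mu> = Sup {ereal d | d :: real. \<exists>C\<^sub>1>0. \<exists>C\<^sub>2>0. \<forall>x\<in>measure_supp \<mu>. \<forall>r. \<forall>R\<in>{0<..<1}.
     0 < r \<and> r < R powr (1 + \<Phi> R) \<and> R powr (1 + \<Phi> R) \<le> R \<and> R \<le> C\<^sub>1 \<longrightarrow>
       measure \<mu> (ball x R) / measure \<mu> (ball x r) \<ge> C\<^sub>2 * (R / r) powr d}"

definition c_val :: "real \<Rightarrow> real \<Rightarrow> real \<Rightarrow> real" where
  "c_val \<theta> a b = a powr \<theta> / (a powr \<theta> + b powr \<theta>)"

text \<open>
  Since \<open>ln 0 = 0\<close>, \<open>Y_val\<close> and \<open>Y'_val\<close> are not meaningful where \<open>p \<in> {0, 1}\<close>; under the moment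
  assumption this is a null event, so the expectations below are not affected.
\<close>

definition Y_val :: "real \<Rightarrow> real \<Rightarrow> real \<Rightarrow> real \<Rightarrow> real" where
  "Y_val \<theta> a b p = (if p \<le> c_val \<theta> a b then ln p else ln (1 - p))"

definition Z_val :: "real \<Rightarrow> real \<Rightarrow> real \<Rightarrow> real \<Rightarrow> real" where
  "Z_val \<theta> a b p = (if p \<le> c_val \<theta> a b then ln a else ln b)"

definition Y'_val :: "real \<Rightarrow> real \<Rightarrow> real \<Rightarrow> real \<Rightarrow> real" where
  "Y'_val \<theta> a b p = (if p > c_val \<theta> a b then ln p else ln (1 - p))"

definition Z'_val :: "real \<Rightarrow> real \<Rightarrow> real \<Rightarrow> real \<Rightarrow> real" where
  "Z'_val \<theta> a b p = (if p > c_val \<theta> a b then ln a else ln b)"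

definition G_fun ::
    "'w measure \<Rightarrow> (nat \<Rightarrow> 'w \<Rightarrow> real) \<Rightarrow> (nat \<Rightarrow> 'w \<Rightarrow> real) \<Rightarrow> (nat \<Rightarrow> 'w \<Rightarrow> real) \<Rightarrow> real \<Rightarrow> real" where
  "G_fun M a b p \<theta> =
     (\<integral>\<omega>. Y_val \<theta> (a 1 \<omega>) (b 1 \<omega>) (p 1 \<omega>) \<partial>M) / (\<integral>\<omega>. Z_val \<theta> (a 1 \<omega>) (b 1 \<omega>) (p 1 \<omega>) \<partial>M)"

definition G'_fun ::
    "'w measure \<Rightarrow> (nat \<Rightarrow> 'w \<Rightarrow> real) \<Rightarrow> (nat \<Rightarrow> 'w \<Rightarrow> real) \<Rightarrow> (nat \<Rightarrow> 'w \<Rightarrow> real) \<Rightarrow> real \<Rightarrow> real" where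
  "G'_fun M a b p \<theta> =
     (\<integral>\<omega>. Y'_val \<theta> (a 1 \<omega>) (b 1 \<omega>) (p 1 \<omega>) \<partial>M) / (\<integral>\<omega>. Z'_val \<theta> (a 1 \<omega>) (b 1 \<omega>) (p 1 \<omega>) \<partial>M)"

text \<open>
  The expectation of \<open>q\<^sup>-\<^sup>t\<close> for \<open>q\<close> with nonnegative values. It is formed in the extended nonnegative
  reals, where \<open>1 / 0 = \<infinity>\<close>: with real \<open>powr\<close> one would have \<open>0 powr (- t) = 0\<close>, and finiteness would
  not force \<open>q > 0\<close> almost surely.
\<close>

definition neg_moment :: "'w measure \<Rightarrow> real \<Rightarrow> ('w \<Rightarrow> real) \<Rightarrow> ennreal" where
  "neg_moment M t q = (\<integral>\<^sup>+\<omega>. 1 / ennreal (q \<omega> powr t) \<partial>M)"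

end

theory Submission
  imports Defs
begin

text \<open>
  Write \<open>len\<close> and \<open>mass\<close> for the length and the measure of a Moran interval. Because siblings are
  separated by a fixed proportion of their parent's length, a ball centred in the support is, up to
  constant factors in the radius, a Moran interval. So the dimensions are determined by comparing, for an
  interval of step \<open>N\<close> and a descendant of step \<open>n\<close>, the quotient of their masses with the \<open>\<psi>\<close>-th
  power of the quotient of their lengths. The logarithm of the first minus that of the second is a sum
  over the steps \<open>i\<close> from \<open>N + 1\<close> to \<open>n\<close> of
  \<open>\<psi> * ln a\<^sub>i - ln p\<^sub>i\<close> for a left step and \<open>\<psi> * ln b\<^sub>i - ln (1 - p\<^sub>i)\<close> for a right step.

  The threshold \<open>c_val\<close> is chosen so that \<open>\<psi> * Z - Y\<close> is the larger of these two numbers and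
  \<open>\<psi> * Z' - Y'\<close> the smaller. Since \<open>Z\<close> and \<open>Z'\<close> are negative, \<open>G < \<psi>\<close> says that the larger number
  has negative mean, and \<open>G' > \<psi>\<close> that the smaller one has positive mean.

  The moment assumption gives exponential moments. So if the mean is negative, then almost surely every
  block of steps that starts at a late \<open>N\<close> and has at least \<open>K * ln N\<close> steps has a nonpositive
  sum (\<open>iid_block_sums_nonpos\<close>). Large dimension functions only compare
  radii \<open>r\<close> and \<open>R\<close> for which the number of steps in between exceeds any multiple of \<open>ln N\<close>
  (\<open>large_dimension_function_scales\<close>). As the larger number bounds the summands of every word
  at once, the estimate is uniform over the support, which bounds the upper dimension from above; in the
  same way the smaller number bounds the lower dimension from below.

  For the two opposite bounds it suffices to look at one point, namely the one that always takes the larger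
  (smaller) branch. The same large deviation estimate shows that around this point the measure of a
  small ball decays faster (slower) than \<open>r powr d\<close>, for each \<open>d < \<psi>\<close> (for each \<open>d > \<psi>\<close>), and this
  is already incompatible with \<open>d\<close> being an admissible exponent for one fixed outer radius.
\<close>

section \<open>Large deviations for blocks of independent summands\<close>

text \<open>
  The difference quotient of \<open>h \<mapsto> exp (h * x)\<close> at \<open>0\<close> increases with \<open>h\<close>, by convexity, and
  decreases to the derivative \<open>x\<close>. So the quotients for \<open>t \<le> s\<close> lie between two functions of
  \<open>x\<close> that do not depend on \<open>t\<close>, which provides a dominating function below.
\<close>

lemma exp_quotient_le:
  fixes x s t :: real
  assumes "0 < t" "t \<le> s"
  shows "x \<le> (exp (t * x) - 1) / t" "(exp (t * x) - 1) / t \<le> (exp (s * x) - 1) / s"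
proof -
  show "x \<le> (exp (t * x) - 1) / t"
    using exp_ge_add_one_self[of "t * x"] assms by (simp add: field_simps)
  have "exp ((1 - t / s) * 0 + (t / s) * (s * x)) \<le> (1 - t / s) * exp 0 + (t / s) * exp (s * x)"
    using convex_onD[OF exp_convex, of "t / s" 0 "s * x"] assms by (simp add: field_simps)
  then have "exp (t * x) - 1 \<le> (t / s) * (exp (s * x) - 1)"
    using assms by (simp add: algebra_simps)
  then show "(exp (t * x) - 1) / t \<le> (exp (s * x) - 1) / s"
    using assms by (simp add: field_simps)
qed

text \<open>
  The function \<open>t \<mapsto> E (exp (t * X))\<close> has value \<open>1\<close> and right derivative \<open>E X < 0\<close> at \<open>0\<close>, so it
  drops below \<open>1\<close> for small \<open>t > 0\<close>. Differentiation under the integral is justified by dominated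
  convergence along \<open>t k = s / (k + 1)\<close>.
\<close>

lemma (in prob_space) exponential_moment_less_one:
  fixes X :: "'a \<Rightarrow> real"
  assumes X: "integrable M X" and s: "s > 0" and expX: "integrable M (\<lambda>\<omega>. exp (s * X \<omega>))"
    and neg: "expectation X < 0"
  obtains t where "t > 0" "integrable M (\<lambda>\<omega>. exp (t * X \<omega>))" "expectation (\<lambda>\<omega>. exp (t * X \<omega>)) < 1"
proof -
  define t where "t k = s / real (Suc k)" for k
  have t: "0 < t k" "t k \<le> s" for k
    using s by (auto simp: t_def field_simps)
  have t0: "t \<longlonglongrightarrow> 0"
    unfolding t_def by (intro LIMSEQ_Suc lim_const_over_n)
  have lim: "(\<lambda>k. (exp (t k * x) - 1) / t k) \<longlonglongrightarrow> x" for x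
  proof -
    have "((\<lambda>h. (exp (h * x) - 1) / h) \<longlongrightarrow> x) (at 0)"
    proof -
      have "((\<lambda>h. exp (h * x)) has_real_derivative x) (at 0)"
        by (auto intro!: derivative_eq_intros)
      then show ?thesis by (simp add: DERIV_def)
    qed
    moreover have "filterlim t (at 0) sequentially"
      using t0 t(1) by (auto simp: filterlim_at intro!: always_eventually) (metis less_irrefl)
    ultimately show ?thesis
      by (rule filterlim_compose)
  qed
  have [measurable]: "X \<in> borel_measurable M" using X by auto
  have "(\<lambda>k. expectation (\<lambda>\<omega>. (exp (t k * X \<omega>) - 1) / t k)) \<longlonglongrightarrow> expectation X"
  proof (rule integral_dominated_convergence)
    show "integrable M (\<lambda>\<omega>. \<bar>X \<omega>\<bar> + \<bar>(exp (s * X \<omega>) - 1) / s\<bar>)"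
      using X expX by (intro Bochner_Integration.integrable_add integrable_abs
          integrable_divide Bochner_Integration.integrable_diff) auto
    show "AE \<omega> in M. norm ((exp (t k * X \<omega>) - 1) / t k) \<le> \<bar>X \<omega>\<bar> + \<bar>(exp (s * X \<omega>) - 1) / s\<bar>" for k
    proof (rule AE_I2)
      fix \<omega>
      show "norm ((exp (t k * X \<omega>) - 1) / t k) \<le> \<bar>X \<omega>\<bar> + \<bar>(exp (s * X \<omega>) - 1) / s\<bar>"
        using exp_quotient_le[OF t(1)[of k] t(2)[of k], where x = "X \<omega>"] unfolding real_norm_def by linarith
    qed
  qed (use lim in auto)
  then have "\<forall>\<^sub>F k in sequentially. expectation (\<lambda>\<omega>. (exp (t k * X \<omega>) - 1) / t k) < 0"
    using neg by (rule order_tendstoD)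
  then obtain k where k: "expectation (\<lambda>\<omega>. (exp (t k * X \<omega>) - 1) / t k) < 0"
    by (auto simp: eventually_sequentially)
  have int: "integrable M (\<lambda>\<omega>. exp (t k * X \<omega>))"
  proof (rule Bochner_Integration.integrable_bound)
    show "integrable M (\<lambda>\<omega>. 1 + exp (s * X \<omega>))" using expX by auto
    have "exp (t k * x) \<le> 1 + exp (s * x)" for x
    proof (cases "x \<ge> 0")
      case True
      then have "exp (t k * x) \<le> exp (s * x)" using t by (simp add: mult_right_mono)
      then show ?thesis by linarith
    next
      case False
      then have "exp (t k * x) \<le> 1" using t(1)[of k] by (simp add: mult_nonneg_nonpos)
      then show ?thesis by (smt (verit) exp_gt_zero)
    qed
    then show "AE \<omega> in M. norm (exp (t k * X \<omega>)) \<le> norm (1 + exp (s * X \<omega>))" 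
      by (auto simp: abs_of_nonneg add_nonneg_nonneg)
  qed auto
  have "expectation (\<lambda>\<omega>. exp (t k * X \<omega>) - 1) < 0"
    using k t(1)[of k] by (simp add: divide_less_0_iff)
  then have "expectation (\<lambda>\<omega>. exp (t k * X \<omega>)) < 1"
    using int by (simp add: prob_space)
  with t(1) int that show thesis by blast
qed

text \<open>
  Chernoff's bound together with the Borel-Cantelli lemma. Independence gives probability at most
  \<open>\<rho> ^ m\<close>, with \<open>\<rho> = E (exp (t * f (V 1))) < 1\<close>, to the event that a block of length \<open>m\<close> has a
  positive sum. A block that starts at \<open>N\<close> and has length at least \<open>K * ln N\<close> is long enough for these
  probabilities to be summable over all starting points and lengths at once: half of the
  exponential decay is spent on a factor \<open>1 / N\<^sup>2\<close>, the other half sums the lengths. The logarithm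
  here is what the notion of a large dimension function corresponds to.
\<close>

lemma (in prob_space) iid_block_sums_nonpos:
  fixes V :: "nat \<Rightarrow> 'a \<Rightarrow> 'b::second_countable_topology" and f :: "'b \<Rightarrow> real"
  assumes indep: "indep_vars (\<lambda>_. borel) V {1..}"
    and ident: "\<And>n. n \<ge> 1 \<Longrightarrow> distr M borel (V n) = distr M borel (V 1)"
    and f [measurable]: "f \<in> borel_measurable borel"
    and int: "integrable M (\<lambda>\<omega>. f (V 1 \<omega>))" and s: "s > 0"
    and expint: "integrable M (\<lambda>\<omega>. exp (s * f (V 1 \<omega>)))"
    and neg: "expectation (\<lambda>\<omega>. f (V 1 \<omega>)) < 0"
  obtains K where "K > 0"
    "AE \<omega> in M. \<exists>N\<^sub>0. \<forall>N\<ge>N\<^sub>0. \<forall>n. real n \<ge> real N + K * ln (real N) \<longrightarrow> (\<Sum>i\<in>{N<..n}. f (V i \<omega>)) \<le> 0"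
proof -
  have V [measurable]: "V i \<in> borel_measurable M" if "i \<ge> 1" for i
    using indep that by (auto simp: indep_vars_def2)
  obtain t where t: "t > 0" and tint: "integrable M (\<lambda>\<omega>. exp (t * f (V 1 \<omega>)))"
    and less1: "expectation (\<lambda>\<omega>. exp (t * f (V 1 \<omega>))) < 1"
    using exponential_moment_less_one[OF int s expint neg] by blast
  define \<rho> where "\<rho> = expectation (\<lambda>\<omega>. exp (t * f (V 1 \<omega>)))"
  have "\<rho> \<ge> 0" unfolding \<rho>_def by (intro integral_nonneg_AE) auto
  \<comment> \<open>The maximum with 1/2 only keeps \<open>\<sigma>\<close> positive, so that its logarithm can be used.\<close>
  define \<sigma> where "\<sigma> = max (1/2) (sqrt \<rho>)"
  have \<sigma>: "0 < \<sigma>" "\<sigma> < 1" "\<rho> \<le> \<sigma> * \<sigma>"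
  proof -
    show "0 < \<sigma>" by (simp add: \<sigma>_def)
    show "\<sigma> < 1" using less1 \<open>\<rho> \<ge> 0\<close> by (auto simp: \<sigma>_def \<rho>_def)
    have "\<rho> = sqrt \<rho> * sqrt \<rho>" using \<open>\<rho> \<ge> 0\<close> by simp
    also have "\<dots> \<le> \<sigma> * \<sigma>" using \<open>\<rho> \<ge> 0\<close> by (intro mult_mono) (auto simp: \<sigma>_def)
    finally show "\<rho> \<le> \<sigma> * \<sigma>" .
  qed
  \<comment> \<open>This constant makes \<open>\<sigma> powr (K * ln N)\<close> equal to \<open>N powr -2\<close>.\<close>
  define K where "K = 2 / - ln \<sigma>"
  have K: "K > 0" using \<sigma> by (auto simp: K_def)
  have same: "integrable M (\<lambda>\<omega>. exp (t * f (V i \<omega>)))" 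
     "expectation (\<lambda>\<omega>. exp (t * f (V i \<omega>))) = \<rho>" if i: "i \<ge> 1" for i
  proof -
    note [measurable] = V[OF i] V[of 1, simplified]
    have "integrable (distr M borel (V 1)) (\<lambda>v. exp (t * f v))"
      using tint by (subst integrable_distr_eq) auto
    then have "integrable (distr M borel (V i)) (\<lambda>v. exp (t * f v))"
      using ident[OF i] by simp
    then show "integrable M (\<lambda>\<omega>. exp (t * f (V i \<omega>)))"
      by (subst (asm) integrable_distr_eq) auto
    have "expectation (\<lambda>\<omega>. exp (t * f (V i \<omega>))) = (\<integral>v. exp (t * f v) \<partial>distr M borel (V i))"
      by (subst integral_distr) auto
    also have "\<dots> = (\<integral>v. exp (t * f v) \<partial>distr M borel (V 1))"
      using ident[OF i] by simp
    also have "\<dots> = \<rho>" unfolding \<rho>_def by (subst integral_distr) auto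
    finally show "expectation (\<lambda>\<omega>. exp (t * f (V i \<omega>))) = \<rho>" .
  qed
  have tail: "prob {\<omega> \<in> space M. (\<Sum>i\<in>{N<..N + m}. f (V i \<omega>)) > 0} \<le> \<rho> ^ m" for N m
  proof -
    let ?I = "{N<..N + m}"
    note [measurable] = V
    have ind: "indep_vars (\<lambda>_. borel) (\<lambda>i \<omega>. exp (t * f (V i \<omega>))) ?I"
    proof -
      have "indep_vars (\<lambda>_. borel) (\<lambda>i. (\<lambda>v. exp (t * f v)) \<circ> V i) {1..}"
        by (rule indep_vars_compose[OF indep]) auto
      then show ?thesis
        by (auto simp: o_def intro: indep_vars_subset)
    qed
    have I: "integrable M (\<lambda>\<omega>. \<Prod>i\<in>?I. exp (t * f (V i \<omega>)))"
      by (rule indep_vars_integrable[OF _ ind]) (auto simp: same)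
    have E: "expectation (\<lambda>\<omega>. \<Prod>i\<in>?I. exp (t * f (V i \<omega>))) = \<rho> ^ m"
      by (subst indep_vars_lebesgue_integral[OF _ ind]) (auto simp: same)
    have eq: "(\<Prod>i\<in>?I. exp (t * f (V i \<omega>))) = exp (t * (\<Sum>i\<in>?I. f (V i \<omega>)))" for \<omega>
      by (simp add: exp_sum sum_distrib_left)
    have meas: "(\<lambda>\<omega>. \<Prod>i\<in>?I. exp (t * f (V i \<omega>))) \<in> borel_measurable M" using I by auto
    have "prob {\<omega> \<in> space M. (\<Sum>i\<in>?I. f (V i \<omega>)) > 0}
      \<le> prob {\<omega> \<in> space M. (\<Prod>i\<in>?I. exp (t * f (V i \<omega>))) \<ge> 1}"
      using meas t by (intro finite_measure_mono) (auto simp: eq intro!: mult_nonneg_nonneg)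
    also have "\<dots> \<le> expectation (\<lambda>\<omega>. \<Prod>i\<in>?I. exp (t * f (V i \<omega>))) / 1"
      by (rule integral_Markov_inequality_measure[OF I, where A = "{}"]) (auto intro!: AE_I2 prod_nonneg)
    finally show ?thesis using E by simp
  qed
  define F where "F = (\<lambda>(N, m). if real m \<ge> K * ln (real N) then {\<omega> \<in> space M. (\<Sum>i\<in>{N<..N + m}. f (V i \<omega>)) > 0} else {})"
  have F_sets: "F k \<in> sets M" for k
  proof -
    note [measurable] = V
    have "{\<omega> \<in> space M. (\<Sum>i\<in>{N<..N + m}. f (V i \<omega>)) > 0} \<in> sets M" for N m
    proof -
      have "(\<lambda>\<omega>. \<Sum>i\<in>{N<..N + m}. f (V i \<omega>)) \<in> borel_measurable M"
        by (intro borel_measurable_sum measurable_compose[OF V f]) auto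
      then show ?thesis by measurable
    qed
    then show ?thesis by (auto simp: F_def split: prod.splits)
  qed
  have F_le: "prob (F (Suc N, m)) \<le> (1 / real (Suc N) ^ 2) * \<sigma> ^ m" for N m
  proof (cases "real m \<ge> K * ln (real (Suc N))")
    case True
    have "\<sigma> ^ m = \<sigma> powr real m" using \<sigma> by (simp add: powr_realpow)
    also have "\<dots> \<le> \<sigma> powr (K * ln (real (Suc N)))"
      using True \<sigma> by (intro powr_mono') auto
    also have "\<dots> = real (Suc N) powr (- 2)"
      using \<sigma> by (simp add: powr_def K_def)
    also have "\<dots> = 1 / real (Suc N) ^ 2"
      by (simp add: powr_minus field_simps powr_numeral)
    finally have 1: "\<sigma> ^ m \<le> 1 / real (Suc N) ^ 2" .
    have "prob (F (Suc N, m)) \<le> \<rho> ^ m"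
      using True tail[of "Suc N" m] by (simp add: F_def)
    also have "\<dots> \<le> (\<sigma> * \<sigma>) ^ m" using \<sigma> \<open>\<rho> \<ge> 0\<close> by (intro power_mono) auto
    also have "\<dots> = \<sigma> ^ m * \<sigma> ^ m" by (simp add: power_mult_distrib)
    also have "\<dots> \<le> (1 / real (Suc N) ^ 2) * \<sigma> ^ m"
      using 1 \<sigma> by (intro mult_right_mono) auto
    finally show ?thesis .
  next
    case False
    then show ?thesis using \<sigma> by (simp add: F_def)
  qed
  define D where "D N = (\<Union>m. F (Suc N, m))" for N
  have D_sets: "D N \<in> sets M" for N using F_sets by (auto simp: D_def)
  have geo: "summable (\<lambda>m. \<sigma> ^ m)" using \<sigma> by (simp add: summable_geometric)
  have D_le: "prob (D N) \<le> (1 / real (Suc N) ^ 2) * suminf (\<lambda>m. \<sigma> ^ m)" for N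
  proof -
    have sm: "summable (\<lambda>m. prob (F (Suc N, m)))"
      by (rule summable_comparison_test'[OF summable_mult[OF geo, of "1 / real (Suc N) ^ 2"], of 0])
        (use F_le in auto)
    have "prob (D N) \<le> (\<Sum>m. prob (F (Suc N, m)))"
      unfolding D_def using sm F_sets by (intro finite_measure_subadditive_countably) auto
    also have "\<dots> \<le> (\<Sum>m. (1 / real (Suc N) ^ 2) * \<sigma> ^ m)"
      by (intro suminf_le F_le sm summable_mult geo)
    also have "\<dots> = (1 / real (Suc N) ^ 2) * suminf (\<lambda>m. \<sigma> ^ m)"
      by (intro suminf_mult geo)
    finally show ?thesis .
  qed
  have "summable (\<lambda>N. prob (D N))"
  proof (rule summable_comparison_test'[where N = 0])
    have "summable (\<lambda>n. 1 / real (Suc n) ^ 2)"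
      using inverse_power_summable[of 2, where 'a = real] by (subst summable_Suc_iff) (auto simp: field_simps)
    then show "summable (\<lambda>N. (1 / real (Suc N) ^ 2) * suminf (\<lambda>m. \<sigma> ^ m))"
      by (rule summable_mult2)
  qed (use D_le in auto)
  then have "AE \<omega> in M. eventually (\<lambda>N. \<omega> \<in> space M - D N) sequentially"
    using D_sets by (intro borel_cantelli_AE1) (auto simp: emeasure_eq_measure)
  then have "AE \<omega> in M. \<exists>N\<^sub>0. \<forall>N\<ge>N\<^sub>0. \<forall>n. real n \<ge> real N + K * ln (real N) \<longrightarrow> (\<Sum>i\<in>{N<..n}. f (V i \<omega>)) \<le> 0"
  proof (eventually_elim)
    case (elim \<omega>)
    then obtain N\<^sub>0 where N0: "\<And>N. N \<ge> N\<^sub>0 \<Longrightarrow> \<omega> \<in> space M - D N"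
      by (auto simp: eventually_sequentially)
    show ?case
    proof (rule exI[of _ "Suc N\<^sub>0"], intro allI impI)
      fix N n assume N: "N \<ge> Suc N\<^sub>0" and n: "real n \<ge> real N + K * ln (real N)"
      then obtain N' where N': "N = Suc N'" "N' \<ge> N\<^sub>0" by (metis Suc_le_D Suc_le_mono)
      have "K * ln (real N) \<ge> 0" using K N' by simp
      then have "n \<ge> N" using n by linarith
      then obtain m where m: "n = N + m" using le_Suc_ex by blast
      have "\<omega> \<notin> F (Suc N', m)" "\<omega> \<in> space M" using N0[OF N'(2)] by (auto simp: D_def)
      then show "(\<Sum>i\<in>{N<..n}. f (V i \<omega>)) \<le> 0"
        using n by (auto simp: F_def N'(1) m not_less)
    qed
  qed
  with K that show thesis by blast
qed

lemma eventually_of_block_sums: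
  fixes f :: "nat \<Rightarrow> real"
  assumes "\<exists>N\<^sub>0. \<forall>N\<ge>N\<^sub>0. \<forall>n. real n \<ge> real N + K * ln (real N) \<longrightarrow> (\<Sum>i\<in>{N<..n}. f i) \<le> 0"
  obtains N where "\<forall>\<^sub>F n in sequentially. (\<Sum>i\<in>{N<..n}. f i) \<le> 0"
proof -
  obtain N where "\<And>n. real n \<ge> real N + K * ln (real N) \<Longrightarrow> (\<Sum>i\<in>{N<..n}. f i) \<le> 0"
    using assms by blast
  then have "\<forall>\<^sub>F n in sequentially. (\<Sum>i\<in>{N<..n}. f i) \<le> 0"
    by (rule eventually_mono[OF eventually_ge_at_top[of "nat \<lceil>real N + K * ln (real N)\<rceil>"]]) linarith
  then show thesis by (rule that)
qed

lemma small_inverse_Suc: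
  assumes "(c::real) > 0" obtains k where "1 / real (Suc k) < c"
  using reals_Archimedean[OF assms] by (auto simp: inverse_eq_divide)

section \<open>Cylinders of a Moran set and balls\<close>

text \<open>
  A Moran interval of step \<open>n\<close> is addressed by a word of left (\<open>True\<close>) and right (\<open>False\<close>) choices.
  Words are infinite sequences indexed from 1, of which step \<open>n\<close> reads the first \<open>n\<close> entries; thus
  one word addresses a whole nested chain of intervals and so a point of the Moran set.
\<close>

definition branch :: "(nat \<Rightarrow> bool) \<Rightarrow> (nat \<Rightarrow> real) \<Rightarrow> (nat \<Rightarrow> real) \<Rightarrow> nat \<Rightarrow> real" where
  "branch s u v i = (if s i then u i else v i)"

primrec cylinder :: "(nat \<Rightarrow> real) \<Rightarrow> (nat \<Rightarrow> real) \<Rightarrow> (nat \<Rightarrow> bool) \<Rightarrow> nat \<Rightarrow> real \<times> real" where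
  "cylinder a b s 0 = (0, 1)"
| "cylinder a b s (Suc n) =
     (if s (Suc n) then left_child (a (Suc n)) (cylinder a b s n)
      else right_child (b (Suc n)) (cylinder a b s n))"

lemma cylinder_cong:
  "(\<And>i. 1 \<le> i \<Longrightarrow> i \<le> n \<Longrightarrow> s i = s' i) \<Longrightarrow> cylinder a b s n = cylinder a b s' n"
  by (induction n) auto

lemma moran_intervals_eq_cylinders: "moran_intervals a b n = range (\<lambda>s. cylinder a b s n)"
proof (induction n)
  case (Suc n)
  have upd: "cylinder a b (s(Suc n := c)) n = cylinder a b s n" for s c
    by (rule cylinder_cong) auto
  show ?case
  proof (intro equalityI subsetI)
    fix I assume "I \<in> moran_intervals a b (Suc n)"
    then obtain J where J: "J \<in> moran_intervals a b n"
      "I = left_child (a (Suc n)) J \<or> I = right_child (b (Suc n)) J" by auto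
    obtain s where "J = cylinder a b s n" using J(1) unfolding Suc by blast
    with J(2) have "I = left_child (a (Suc n)) (cylinder a b s n) \<or> I = right_child (b (Suc n)) (cylinder a b s n)"
      by simp
    then have "I = cylinder a b (s(Suc n := True)) (Suc n) \<or> I = cylinder a b (s(Suc n := False)) (Suc n)"
      by (simp add: upd)
    then show "I \<in> range (\<lambda>s. cylinder a b s (Suc n))" by blast
  qed (use Suc in auto)
qed auto

lemma greaterThanAtMost_Suc: "m \<le> n \<Longrightarrow> {m<..Suc n} = insert (Suc n) {m<..n}"
  by auto

locale moran_system =
  fixes a b p :: "nat \<Rightarrow> real" and \<mu> :: "real measure" and A B :: real
  assumes A_pos: "0 < A" and B_less_1: "B < 1"
    and a_ge: "\<And>n. n \<ge> 1 \<Longrightarrow> A \<le> a n" and b_ge: "\<And>n. n \<ge> 1 \<Longrightarrow> A \<le> b n"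
    and ab_le: "\<And>n. n \<ge> 1 \<Longrightarrow> a n + b n \<le> B"
    and p_pos: "\<And>n. n \<ge> 1 \<Longrightarrow> 0 < p n" and p_less_1: "\<And>n. n \<ge> 1 \<Longrightarrow> p n < 1"
    and moran: "is_moran_measure a b p \<mu>"
begin

sublocale prob_space \<mu>
  using moran by (simp add: is_moran_measure_def)

lemma sets_eq [measurable_cong, simp]: "sets \<mu> = sets borel"
  using moran by (simp add: is_moran_measure_def)

abbreviation cyl :: "(nat \<Rightarrow> bool) \<Rightarrow> nat \<Rightarrow> real \<times> real" where "cyl \<equiv> cylinder a b"

definition shrink :: "(nat \<Rightarrow> bool) \<Rightarrow> nat \<Rightarrow> real" where "shrink s = branch s a b"
definition weight :: "(nat \<Rightarrow> bool) \<Rightarrow> nat \<Rightarrow> real" where "weight s = branch s p (\<lambda>i. 1 - p i)"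
definition len :: "(nat \<Rightarrow> bool) \<Rightarrow> nat \<Rightarrow> real" where "len s n = (\<Prod>i\<in>{0<..n}. shrink s i)"
definition mass :: "(nat \<Rightarrow> bool) \<Rightarrow> nat \<Rightarrow> real" where "mass s n = (\<Prod>i\<in>{0<..n}. weight s i)"

text \<open>
  Since both ratios are at least \<open>A\<close> and their sum is at most \<open>B < 1\<close>, each ratio lies in
  \<open>[A, B]\<close>: lengths of nested cylinders decay at a controlled exponential rate.
\<close>

lemma shrink_bounds: "n \<ge> 1 \<Longrightarrow> A \<le> shrink s n" "n \<ge> 1 \<Longrightarrow> shrink s n \<le> B"
  using a_ge[of n] b_ge[of n] ab_le[of n] A_pos by (auto simp: shrink_def branch_def)

lemma shrink_pos: "n \<ge> 1 \<Longrightarrow> 0 < shrink s n"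
  using shrink_bounds(1)[of n s] A_pos by simp

lemma A_less_B: "A < B" and B_pos: "0 < B"
  using a_ge[of 1] b_ge[of 1] ab_le[of 1] A_pos by auto

lemma A_less_1: "A < 1"
  using A_less_B B_less_1 by simp

lemma weight_pos: "n \<ge> 1 \<Longrightarrow> 0 < weight s n"
  using p_pos[of n] p_less_1[of n] by (auto simp: weight_def branch_def)

lemma len_0 [simp]: "len s 0 = 1" and mass_0 [simp]: "mass s 0 = 1"
  by (simp_all add: len_def mass_def)

lemma len_Suc: "len s (Suc n) = shrink s (Suc n) * len s n"
  by (simp add: len_def greaterThanAtMost_Suc)

lemma mass_Suc: "mass s (Suc n) = weight s (Suc n) * mass s n"
  by (simp add: mass_def greaterThanAtMost_Suc)

lemma len_pos: "0 < len s n" and mass_pos: "0 < mass s n"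
  unfolding len_def mass_def by (auto intro!: prod_pos shrink_pos weight_pos)

lemma len_Suc_less: "len s (Suc n) < len s n"
  using shrink_bounds(2)[of "Suc n" s] B_less_1 len_pos[of s n] by (simp add: len_Suc)

lemma len_antimono: "m \<le> n \<Longrightarrow> len s n \<le> len s m"
  by (rule lift_Suc_antimono_le[of "len s"]) (rule less_imp_le[OF len_Suc_less])

lemma A_len_le: "A * len s n \<le> len s (Suc n)"
  using shrink_bounds(1)[of "Suc n" s] len_pos[of s n] by (simp add: len_Suc mult_right_mono)

lemma len_le_power: "len s n \<le> B ^ n"
proof (induction n)
  case (Suc n)
  then show ?case
    using shrink_bounds(2)[of "Suc n" s] shrink_pos[of "Suc n" s] B_pos len_pos[of s n]
    by (simp add: len_Suc mult_mono)
qed simp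

lemma len_ge_power_diff: "N \<le> n \<Longrightarrow> A ^ (n - N) * len s N \<le> len s n"
proof (induction n rule: dec_induct)
  case (step n)
  have "A ^ (Suc n - N) * len s N = A * (A ^ (n - N) * len s N)"
    using step by (simp add: Suc_diff_le)
  also have "\<dots> \<le> A * len s n" using step A_pos by (intro mult_left_mono) auto
  also have "\<dots> \<le> len s (Suc n)" by (rule A_len_le)
  finally show ?case .
qed simp

lemma len_tendsto_0: "len s \<longlonglongrightarrow> 0"
proof (rule tendsto_sandwich[OF _ _ tendsto_const])
  show "(\<lambda>n. B ^ n) \<longlonglongrightarrow> 0" using B_pos B_less_1 by (intro LIMSEQ_power_zero) simp
qed (auto intro!: always_eventually len_le_power less_imp_le len_pos)

lemma ln_len_diff: "N \<le> n \<Longrightarrow> ln (len s n) = ln (len s N) + (\<Sum>i\<in>{N<..n}. ln (shrink s i))"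
proof (induction n rule: dec_induct)
  case (step n)
  then show ?case
    using shrink_pos[of "Suc n" s] len_pos[of s n] by (simp add: len_Suc ln_mult greaterThanAtMost_Suc)
qed simp

lemma ln_mass_diff: "N \<le> n \<Longrightarrow> ln (mass s n) = ln (mass s N) + (\<Sum>i\<in>{N<..n}. ln (weight s i))"
proof (induction n rule: dec_induct)
  case (step n)
  then show ?case
    using weight_pos[of "Suc n" s] mass_pos[of s n] by (simp add: mass_Suc ln_mult greaterThanAtMost_Suc)
qed simp

lemma cyl_length: "snd (cyl s n) - fst (cyl s n) = len s n"
proof (induction n)
  case (Suc n)
  then show ?case
    by (cases "cyl s n") (auto simp: left_child_def right_child_def len_Suc shrink_def branch_def)
qed simp

lemma segment_cyl: "segment (cyl s n) = {fst (cyl s n)..fst (cyl s n) + len s n}"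
proof -
  have "snd (cyl s n) = fst (cyl s n) + len s n" using cyl_length[of s n] by linarith
  then show ?thesis by (simp only: segment_def)
qed

lemma fst_cyl_Suc:
  "fst (cyl s (Suc n)) = fst (cyl s n) + (if s (Suc n) then 0 else len s n - len s (Suc n))"
proof (cases "s (Suc n)")
  case True
  then show ?thesis by (cases "cyl s n") (simp add: left_child_def)
next
  case False
  then have "snd (cyl s (Suc n)) = snd (cyl s n)"
    by (cases "cyl s n") (simp add: right_child_def)
  then show ?thesis
    using False cyl_length[of s n] cyl_length[of s "Suc n"] by (simp del: cylinder.simps)
qed

lemma segment_Suc_subset: "segment (cyl s (Suc n)) \<subseteq> segment (cyl s n)"
proof -
  have "fst (cyl s n) \<le> fst (cyl s (Suc n))" "fst (cyl s (Suc n)) + len s (Suc n) \<le> fst (cyl s n) + len s n"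
    using len_Suc_less[of s n] fst_cyl_Suc[of s n] by (simp_all split: if_splits del: cylinder.simps)
  then show ?thesis by (simp only: segment_cyl atLeastatMost_subset_iff) simp
qed

lemma segment_antimono: "m \<le> n \<Longrightarrow> segment (cyl s n) \<subseteq> segment (cyl s m)"
  by (rule lift_Suc_antimono_le[of "\<lambda>n. segment (cyl s n)"]) (rule segment_Suc_subset)

lemma measure_cyl: "measure \<mu> (segment (cyl s n)) = mass s n"
proof (induction n)
  case 0
  then show ?case using moran by (simp add: is_moran_measure_def segment_def)
next
  case (Suc n)
  have "cyl s n \<in> moran_intervals a b n" by (auto simp: moran_intervals_eq_cylinders)
  then show ?case
    using moran Suc by (auto simp: is_moran_measure_def mass_Suc weight_def branch_def)
qed

text \<open>
  Siblings are separated by a gap of relative size \<open>1 - a - b \<ge> 1 - B\<close>. At the first step where two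
  words differ, their points are therefore at least \<open>1 - B\<close> times the parent's length apart, and the
  parent at an earlier step is even longer. For \<open>n = 0\<close> there is nothing to compare; for \<open>n > 0\<close>
  the index \<open>n - 1\<close> is the step of the parent.
\<close>

lemma cylinders_separated:
  assumes "x \<in> segment (cyl s n)" "y \<in> segment (cyl s' n)" "\<bar>x - y\<bar> < (1 - B) * len s (n - 1)"
  shows "\<forall>i\<in>{1..n}. s i = s' i"
  using assms
proof (induction n)
  case (Suc n)
  have "(1 - B) * len s n \<le> (1 - B) * len s (n - 1)"
    using B_less_1 by (intro mult_left_mono len_antimono) auto
  then have IH: "\<forall>i\<in>{1..n}. s i = s' i"
    using Suc.IH Suc.prems segment_Suc_subset[of s n] segment_Suc_subset[of s' n] by force
  have same: "cyl s n = cyl s' n" "len s n = len s' n"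
    using IH by (auto intro!: cylinder_cong prod.cong simp: len_def shrink_def branch_def)
  have ab: "(a (Suc n) + b (Suc n)) * len s n \<le> B * len s n"
    using ab_le[of "Suc n"] len_pos[of s n] by (intro mult_right_mono) auto
  have "s (Suc n) = s' (Suc n)"
  proof (rule ccontr)
    assume ne: "s (Suc n) \<noteq> s' (Suc n)"
    have "(1 - B) * len s n \<le> \<bar>x - y\<bar>"
      using Suc.prems(1,2) ab ne unfolding segment_cyl fst_cyl_Suc same len_Suc shrink_def branch_def
      by (cases "s (Suc n)") (auto simp: algebra_simps)
    then show False using Suc.prems(3) by simp
  qed
  with IH show ?case by (auto simp: le_Suc_eq)
qed simp

lemma measure_Int_moran_set:
  assumes "S \<in> sets borel" shows "measure \<mu> S = measure \<mu> (S \<inter> moran_set a b)"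
proof -
  have 1: "measure \<mu> (moran_set a b) = 1" using moran by (simp add: is_moran_measure_def)
  then have m: "moran_set a b \<in> events" by (metis measure_notin_sets zero_neq_one)
  have ae: "AE x in \<mu>. x \<in> moran_set a b" using 1 m by (simp add: prob_eq_1)
  show ?thesis
    by (rule finite_measure_eq_AE) (use assms m ae in auto)
qed

text \<open>
  A ball whose radius is below the gap at step \<open>n\<close> cannot leave the cylinder of its centre at step
  \<open>Suc n\<close> without leaving the Moran set, which carries all the mass. With its converse
  \<open>mass_le_measure_ball\<close> this compares balls with cylinders of comparable size.
\<close>

lemma measure_ball_le_mass:
  assumes x: "\<And>n. x \<in> segment (cyl s n)" and r: "r \<le> (1 - B) * len s n"
  shows "measure \<mu> (ball x r) \<le> mass s (Suc n)"
proof -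
  have "ball x r \<inter> moran_set a b \<subseteq> segment (cyl s (Suc n))"
  proof
    fix y assume y: "y \<in> ball x r \<inter> moran_set a b"
    then have "y \<in> (\<Union>I\<in>moran_intervals a b (Suc n). segment I)" unfolding moran_set_def by blast
    then obtain s' where s': "y \<in> segment (cyl s' (Suc n))"
      unfolding moran_intervals_eq_cylinders by blast
    have "\<forall>i\<in>{1..Suc n}. s i = s' i"
      by (rule cylinders_separated[OF x s']) (use y r in \<open>auto simp: dist_real_def\<close>)
    then have "cyl s (Suc n) = cyl s' (Suc n)" by (intro cylinder_cong) auto
    then show "y \<in> segment (cyl s (Suc n))" using s' by simp
  qed
  then have "measure \<mu> (ball x r \<inter> moran_set a b) \<le> measure \<mu> (segment (cyl s (Suc n)))"
    by (intro finite_measure_mono) (simp_all add: segment_cyl del: cylinder.simps)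
  then show ?thesis using measure_Int_moran_set[of "ball x r"] measure_cyl[of s "Suc n"] by simp
qed

lemma mass_le_measure_ball:
  assumes x: "x \<in> segment (cyl s n)" and r: "len s n < r"
  shows "mass s n \<le> measure \<mu> (ball x r)"
proof -
  have "segment (cyl s n) \<subseteq> ball x r"
    using x r by (auto simp: segment_cyl dist_real_def)
  then have "measure \<mu> (segment (cyl s n)) \<le> measure \<mu> (ball x r)"
    by (intro finite_measure_mono) auto
  then show ?thesis by (simp add: measure_cyl)
qed

lemma measure_ball_pos:
  assumes x: "\<And>n. x \<in> segment (cyl s n)" and r: "r > 0"
  shows "0 < measure \<mu> (ball x r)"
proof -
  have "\<forall>\<^sub>F n in sequentially. len s n < r" using len_tendsto_0 r by (rule order_tendstoD)
  then obtain n where "len s n < r" by (auto simp: eventually_sequentially)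
  then show ?thesis using mass_le_measure_ball[OF x[of n]] mass_pos[of s n] by fastforce
qed

lemma mem_measure_supp:
  assumes x: "\<And>n. x \<in> segment (cyl s n)"
  shows "x \<in> measure_supp \<mu>"
  unfolding measure_supp_def
proof (intro CollectI allI impI)
  fix U assume U: "open U \<and> x \<in> U"
  then obtain e where e: "e > 0" "ball x e \<subseteq> U" by (meson openE)
  have "0 < emeasure \<mu> (ball x e)" using measure_ball_pos[OF x e(1)] by (simp add: emeasure_eq_measure)
  also have "\<dots> \<le> emeasure \<mu> U" using e U by (intro emeasure_mono) auto
  finally show "0 < emeasure \<mu> U" .
qed

lemma exists_point: "\<exists>x. \<forall>n. x \<in> segment (cyl s n)"
proof -
  have "(\<Inter>n. segment (cyl s n)) \<noteq> {}"
    by (rule compact_nest) (use segment_antimono len_pos[of s] in \<open>auto simp: segment_cyl intro: less_imp_le\<close>)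
  then show ?thesis by auto
qed

lemma finite_moran_intervals: "finite (moran_intervals a b n)"
  by (induction n) auto

lemma closed_moran_set: "closed (moran_set a b)"
  unfolding moran_set_def segment_def
  by (intro closed_INT closed_UN ballI finite_moran_intervals) auto

text \<open>
  The Moran set is closed and has full measure, so it contains the support. A point of it lies in
  some cylinder at each step, and separation (at distance \<open>0\<close>) makes the words found at different
  steps prefixes of one another, so that they glue to a single infinite word.
\<close>

lemma measure_supp_coding:
  assumes "x \<in> measure_supp \<mu>"
  obtains s where "\<And>n. x \<in> segment (cyl s n)"
proof -
  have "x \<in> moran_set a b"
  proof (rule ccontr)
    assume "x \<notin> moran_set a b"
    then have "emeasure \<mu> (- moran_set a b) > 0"
      using assms closed_moran_set by (auto simp: measure_supp_def open_closed)
    moreover have "measure \<mu> (- moran_set a b) = 0"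
      using measure_Int_moran_set[of "- moran_set a b"] closed_moran_set by auto
    ultimately show False by (simp add: emeasure_eq_measure)
  qed
  then have "\<exists>s. x \<in> segment (cyl s n)" for n
  proof -
    have "x \<in> (\<Union>I\<in>moran_intervals a b n. segment I)" 
      using \<open>x \<in> moran_set a b\<close> unfolding moran_set_def by blast
    then show ?thesis unfolding moran_intervals_eq_cylinders by blast
  qed
  then obtain w where w: "\<And>n. x \<in> segment (cyl (w n) n)" by metis
  define s where "s i = w i i" for i
  have "x \<in> segment (cyl s n)" for n
  proof -
    have "w n i = s i" if i: "1 \<le> i" "i \<le> n" for i
    proof -
      have "x \<in> segment (cyl (w n) i)" using w[of n] segment_antimono[OF i(2), of "w n"] by auto
      then have "\<forall>j\<in>{1..i}. w n j = w i j"
        by (rule cylinders_separated[OF _ w[of i]]) (use B_less_1 len_pos in auto)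
      then show ?thesis using i by (simp add: s_def)
    qed
    then have "cyl s n = cyl (w n) n" by (intro cylinder_cong) auto
    then show ?thesis using w[of n] by simp
  qed
  then show thesis by (rule that)
qed

text \<open>
  The first step at which the length, times \<open>c\<close>, falls below \<open>\<rho>\<close>. As one step shrinks lengths by a
  factor at least \<open>A\<close>, the length there is still comparable to \<open>\<rho>\<close>. It is used with \<open>c = 1\<close> for
  cylinders inside a ball and with \<open>c = 1 - B\<close> for cylinders that trap a ball.
\<close>

lemma scale_exists:
  assumes c: "0 < c" "c \<le> 1" and \<rho>: "0 < \<rho>" "\<rho> \<le> c"
  obtains n where "c * len s (Suc n) < \<rho>" "\<rho> \<le> c * len s n" "A * \<rho> \<le> len s (Suc n)"
proof -
  have "\<forall>\<^sub>F n in sequentially. len s n < \<rho> / c"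
    using len_tendsto_0 by (rule order_tendstoD) (use c \<rho> in auto)
  then obtain m where m: "c * len s m < \<rho>" using c by (auto simp: eventually_sequentially field_simps)
  define k where "k = (LEAST k. c * len s k < \<rho>)"
  have k: "c * len s k < \<rho>" unfolding k_def using m by (rule LeastI)
  have "k \<noteq> 0" using k \<rho> by (cases k) auto
  then obtain n where n: "k = Suc n" using not0_implies_Suc by blast
  have "\<not> c * len s n < \<rho>" using not_less_Least[of n "\<lambda>k. c * len s k < \<rho>"] n by (simp add: k_def)
  then have 1: "\<rho> \<le> c * len s n" by simp
  have "A * \<rho> \<le> A * (c * len s n)" using 1 A_pos by simp
  also have "\<dots> \<le> A * len s n" using A_pos c len_pos[of s n] by simp
  also have "\<dots> \<le> len s (Suc n)" by (rule A_len_le)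
  finally show thesis using that k n 1 by blast
qed

end

section \<open>Exponents of a Moran measure\<close>

definition upper_exponent :: "(real \<Rightarrow> real) \<Rightarrow> 'a::metric_space measure \<Rightarrow> real \<Rightarrow> bool" where
  "upper_exponent \<Phi> \<mu> d \<longleftrightarrow> (\<exists>C\<^sub>1>0. \<exists>C\<^sub>2>0. \<forall>x\<in>measure_supp \<mu>. \<forall>r. \<forall>R\<in>{0<..<1}.
     0 < r \<and> r < R powr (1 + \<Phi> R) \<and> R powr (1 + \<Phi> R) \<le> R \<and> R \<le> C\<^sub>1 \<longrightarrow>
       measure \<mu> (ball x R) / measure \<mu> (ball x r) \<le> C\<^sub>2 * (R / r) powr d)"

definition lower_exponent :: "(real \<Rightarrow> real) \<Rightarrow> 'a::metric_space measure \<Rightarrow> real \<Rightarrow> bool" where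
  "lower_exponent \<Phi> \<mu> d \<longleftrightarrow> (\<exists>C\<^sub>1>0. \<exists>C\<^sub>2>0. \<forall>x\<in>measure_supp \<mu>. \<forall>r. \<forall>R\<in>{0<..<1}.
     0 < r \<and> r < R powr (1 + \<Phi> R) \<and> R powr (1 + \<Phi> R) \<le> R \<and> R \<le> C\<^sub>1 \<longrightarrow>
       measure \<mu> (ball x R) / measure \<mu> (ball x r) \<ge> C\<^sub>2 * (R / r) powr d)"

lemma upper_dim_eq: "upper_dim \<Phi> \<mu> = Inf {ereal d | d. upper_exponent \<Phi> \<mu> d}"
  by (simp add: upper_dim_def upper_exponent_def)

lemma lower_dim_eq: "lower_dim \<Phi> \<mu> = Sup {ereal d | d. lower_exponent \<Phi> \<mu> d}"
  by (simp add: lower_dim_def lower_exponent_def)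

lemma dimension_function_powr_le:
  assumes "dimension_function \<Phi>" "0 < R" "R < 1"
  shows "R powr (1 + \<Phi> R) \<le> R"
proof -
  have "R powr (1 + \<Phi> R) \<le> R powr 1"
    using assms by (intro powr_mono') (auto simp: dimension_function_def)
  then show ?thesis using assms by simp
qed

context moran_system
begin

text \<open>
  How the largeness of \<open>\<Phi>\<close> enters. Let the cylinder lengths at steps \<open>N\<close> and \<open>n\<close> be comparable to
  \<open>R\<close> and \<open>r\<close>, and put \<open>L = -ln R\<close>. Then \<open>N\<close> is of the order of \<open>L\<close>, so \<open>ln N\<close> is at most about
  \<open>ln L\<close>, while \<open>r < R powr (1 + \<Phi> R)\<close> forces \<open>ln (R / r) > H R * ln L\<close> and hence \<open>n - N\<close> to be at
  least a constant times \<open>H R * ln L\<close>. As \<open>H R\<close> tends to infinity, the number of steps between the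
  two scales exceeds \<open>K * ln N\<close> for every fixed \<open>K\<close>.
\<close>

lemma large_dimension_function_scales:
  assumes large: "large_dimension_function \<Phi>" and K: "K > 0"
  obtains C where "0 < C" "C \<le> 1 - B"
    "\<And>R r s N n. 0 < R \<Longrightarrow> R \<le> C \<Longrightarrow> 0 < r \<Longrightarrow> r < R powr (1 + \<Phi> R) \<Longrightarrow>
       A * R \<le> len s N \<Longrightarrow> (1 - B) * len s N < R \<Longrightarrow> A * r \<le> len s n \<Longrightarrow> (1 - B) * len s n < r \<Longrightarrow>
       N\<^sub>0 \<le> N \<and> real N + K * ln (real N) \<le> real n"
proof -
  define \<kappa> where "\<kappa> = 1 - B"
  have \<kappa>: "0 < \<kappa>" "\<kappa> < 1" using B_less_1 B_pos by (auto simp: \<kappa>_def)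
  define \<alpha> where "\<alpha> = - ln A"
  have \<alpha>: "\<alpha> > 0" using A_pos A_less_1 by (simp add: \<alpha>_def)
  define \<beta> where "\<beta> = - ln B"
  have \<beta>: "\<beta> > 0" using B_pos B_less_1 by (simp add: \<beta>_def)
  obtain H where H: "filterlim H at_top (at_right 0)"
    and \<Phi>: "\<forall>\<^sub>F t in at_right 0. \<Phi> t = H t * (ln \<bar>ln t\<bar> / \<bar>ln t\<bar>)"
    using large by (auto simp: large_dimension_function_def)
  have Lim: "filterlim (\<lambda>R::real. - ln R) at_top (at_right 0)"
    using ln_at_0 by (simp add: filterlim_uminus_at_bot)
  \<comment> \<open>\<open>L\<close> must exceed constants for several reasons: \<open>ln L\<close> must dominate 1 and \<open>- ln (A * \<kappa>)\<close>,
    \<open>(L + \<alpha>) / \<beta>\<close> must be at most \<open>L\<^sup>2\<close>, and \<open>N\<close> must exceed \<open>N\<^sub>0\<close>.\<close>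
  define L0 where "L0 = Max {exp 1, exp (- ln (A * \<kappa>)), \<alpha>, 2 / \<beta>, (real N\<^sub>0 + 1) * \<alpha> - ln \<kappa>}"
  have "\<forall>\<^sub>F R in at_right 0. \<Phi> R = H R * (ln \<bar>ln R\<bar> / \<bar>ln R\<bar>) \<and> H R \<ge> 2 * K * \<alpha> + 2 \<and> - ln R \<ge> L0"
    using \<Phi> H Lim by (auto simp: filterlim_at_top intro!: eventually_conj)
  then obtain C0 where C0: "C0 > 0" and ev: "\<And>R. 0 < R \<Longrightarrow> R < C0 \<Longrightarrow>
      \<Phi> R = H R * (ln \<bar>ln R\<bar> / \<bar>ln R\<bar>) \<and> H R \<ge> 2 * K * \<alpha> + 2 \<and> - ln R \<ge> L0"
    by (auto simp: eventually_at_right_field)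
  define C where "C = min (C0 / 2) \<kappa>"
  show thesis
  proof (rule that[of C])
    show "0 < C" "C \<le> 1 - B" using C0 \<kappa> by (auto simp: C_def \<kappa>_def)
  next
    fix R r s N n
    assume R: "0 < R" "R \<le> C" and r: "0 < r" "r < R powr (1 + \<Phi> R)"
      and N: "A * R \<le> len s N" "(1 - B) * len s N < R"
      and n: "A * r \<le> len s n" "(1 - B) * len s n < r"
    define L where "L = - ln R"
    have C: "R < C0" using R C0 by (auto simp: C_def)
    have LL0: "L \<ge> L0" using ev[OF R(1) C] by (simp add: L_def)
    then have L: "L \<ge> exp 1" "L \<ge> exp (- ln (A * \<kappa>))" "L \<ge> \<alpha>" "L \<ge> 2 / \<beta>" "L \<ge> (real N\<^sub>0 + 1) * \<alpha> - ln \<kappa>"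
      by (simp_all add: L0_def)
    have Lpos: "L > 0" using L(1) exp_gt_zero[of "1::real"] by linarith
    have lnL: "ln L \<ge> 1" "ln L \<ge> - ln (A * \<kappa>)"
      using L(1,2) Lpos by (simp_all add: ln_ge_iff)
    have \<Phi>L: "\<Phi> R * L = H R * ln L" "H R \<ge> 2 * K * \<alpha> + 2"
      using ev[OF R(1) C] Lpos by (auto simp: L_def)
    \<comment> \<open>Lengths shrink at most by \<open>A\<close> per step, so a small \<open>R\<close> is reached only late.\<close>
    have "\<kappa> * A ^ N \<le> \<kappa> * len s N" 
      using len_ge_power_diff[of 0 N s] \<kappa> by simp
    then have "\<kappa> * A ^ N < R" using N(2) by (simp add: \<kappa>_def)
    then have "ln (\<kappa> * A ^ N) < ln R" using \<kappa> A_pos R by (subst ln_less_cancel_iff) auto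
    then have "ln \<kappa> - real N * \<alpha> < - L"
      using \<kappa> A_pos by (simp add: ln_mult ln_realpow \<alpha>_def L_def)
    then have "(real N\<^sub>0 + 1) * \<alpha> < real N * \<alpha>" using L(5) by linarith
    then have N0: "N\<^sub>0 + 1 \<le> N" using \<alpha> by simp
    \<comment> \<open>Lengths shrink at least by \<open>B\<close> per step. The bound \<open>N \<le> 2 * L / \<beta>\<close> is weakened to \<open>L\<^sup>2\<close>
      to absorb the constant into a factor 2 after taking logarithms.\<close>
    have "A * R \<le> B ^ N" using N(1) len_le_power[of s N] by linarith
    then have "ln (A * R) \<le> ln (B ^ N)" using A_pos R B_pos by (subst ln_le_cancel_iff) auto
    then have "- \<alpha> - L \<le> - (real N * \<beta>)"
      using A_pos R B_pos by (simp add: ln_mult ln_realpow \<alpha>_def \<beta>_def L_def)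
    then have "real N * \<beta> \<le> 2 * L" using L(3) by linarith
    also have "\<dots> \<le> (L * \<beta>) * L" using L(4) \<beta> Lpos by (intro mult_right_mono) (simp_all add: field_simps)
    finally have "real N * \<beta> \<le> L\<^sup>2 * \<beta>" by (simp add: power2_eq_square mult_ac)
    then have "real N \<le> L\<^sup>2" using \<beta> by simp
    then have "ln (real N) \<le> ln (L\<^sup>2)" using N0 Lpos by (subst ln_le_cancel_iff) auto
    then have lnN: "ln (real N) \<le> 2 * ln L" using Lpos by (simp add: ln_realpow)
    \<comment> \<open>The ratio of the two lengths is about \<open>R / r\<close>, which is large, and at most \<open>A\<close> to the
      power \<open>N - n\<close>.\<close>
    have "ln r < ln (R powr (1 + \<Phi> R))" using r by (subst ln_less_cancel_iff) auto
    then have lnr: "ln r < - L - H R * ln L"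
      using R \<Phi>L(1) by (simp add: ln_powr L_def algebra_simps)
    have "ln (A * R) \<le> ln (len s N)" using N(1) A_pos R len_pos[of s N] by (subst ln_le_cancel_iff) auto
    then have 1: "ln A - L \<le> ln (len s N)" using A_pos R by (simp add: ln_mult L_def)
    have "ln (\<kappa> * len s n) < ln r"
      using n(2) \<kappa> r len_pos[of s n] by (subst ln_less_cancel_iff) (auto simp: \<kappa>_def)
    then have 2: "ln \<kappa> + ln (len s n) < ln r" using \<kappa> len_pos[of s n] by (simp add: ln_mult)
    have "ln (A * \<kappa>) = ln A + ln \<kappa>" using A_pos \<kappa> by (simp add: ln_mult)
    then have "ln (len s N) - ln (len s n) > H R * ln L - ln L"
      using 1 2 lnr lnL(2) by linarith
    moreover have "H R * ln L \<ge> (2 * K * \<alpha> + 2) * ln L"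
      using \<Phi>L(2) lnL(1) by (intro mult_right_mono) auto
    ultimately have gap: "ln (len s N) - ln (len s n) > 2 * K * \<alpha> * ln L"
      using lnL(1) by (simp add: algebra_simps)
    have "2 * K * \<alpha> * ln L \<ge> 0" using K \<alpha> lnL(1) by simp
    then have "ln (len s n) < ln (len s N)" using gap by linarith
    then have "len s n < len s N" using len_pos[of s n] len_pos[of s N] by simp
    then have Nn: "N \<le> n" using len_antimono[of n N s] by force
    have "ln (A ^ (n - N) * len s N) \<le> ln (len s n)"
      using len_ge_power_diff[OF Nn, of s] A_pos len_pos[of s n] len_pos[of s N] by (subst ln_le_cancel_iff) auto
    then have "ln (len s N) - ln (len s n) \<le> real (n - N) * \<alpha>"
      using A_pos len_pos[of s N] by (simp add: ln_mult ln_realpow \<alpha>_def)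
    then have "(2 * K * ln L) * \<alpha> < real (n - N) * \<alpha>" using gap by (simp add: mult_ac)
    then have "2 * K * ln L < real (n - N)" using \<alpha> by simp
    moreover have "K * ln (real N) \<le> K * (2 * ln L)" using K lnN by (intro mult_left_mono) auto
    ultimately show "N\<^sub>0 \<le> N \<and> real N + K * ln (real N) \<le> real n"
      using N0 Nn by (simp add: of_nat_diff)
  qed
qed

lemma inner_radius_le_outer_radius:
  "0 < R \<Longrightarrow> R \<le> 1 - B \<Longrightarrow> 0 < r \<Longrightarrow> r < R powr (1 + \<Phi> R) \<Longrightarrow> dimension_function \<Phi> \<Longrightarrow> r \<le> R"
  using dimension_function_powr_le[of \<Phi> R] B_pos by force

text \<open>
  The exponent bound for balls reduces to one for cylinders: the outer ball is trapped in a cylinder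
  of comparable size, the inner ball contains one, and large dimension functions only see pairs of
  steps that are logarithmically far apart.
\<close>

lemma upper_exponentI:
  assumes large: "large_dimension_function \<Phi>" and "\<psi> \<ge> 0" and K: "K > 0"
    and bound: "\<And>s N n. N \<ge> N\<^sub>0 \<Longrightarrow> real N + K * ln (real N) \<le> real n \<Longrightarrow>
      mass s N / mass s n \<le> (len s N / len s n) powr \<psi>"
  shows "upper_exponent \<Phi> \<mu> \<psi>"
proof -
  have dim: "dimension_function \<Phi>" using large by (simp add: large_dimension_function_def)
  have \<kappa>: "0 < 1 - B" "1 - B \<le> 1" using B_less_1 B_pos by auto
  obtain C where C: "0 < C" "C \<le> 1 - B" and sc:
    "\<And>R r s N n. 0 < R \<Longrightarrow> R \<le> C \<Longrightarrow> 0 < r \<Longrightarrow> r < R powr (1 + \<Phi> R) \<Longrightarrow>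
       A * R \<le> len s N \<Longrightarrow> (1 - B) * len s N < R \<Longrightarrow> A * r \<le> len s n \<Longrightarrow> (1 - B) * len s n < r \<Longrightarrow>
       N\<^sub>0 \<le> N \<and> real N + K * ln (real N) \<le> real n"
    using large_dimension_function_scales[OF large K, where N\<^sub>0 = N\<^sub>0] by blast
  have "measure \<mu> (ball x R) / measure \<mu> (ball x r) \<le> (1 / (A * (1 - B))) powr \<psi> * (R / r) powr \<psi>"
    if x: "x \<in> measure_supp \<mu>" and R: "0 < R" "R \<le> C" and r: "0 < r" "r < R powr (1 + \<Phi> R)" for x r R
  proof -
    obtain s where s: "\<And>n. x \<in> segment (cyl s n)" using measure_supp_coding[OF x] by blast
    have RB: "R \<le> 1 - B" using R C by simp
    have rR: "r \<le> R" using inner_radius_le_outer_radius[OF R(1) RB r dim] .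
    obtain m where m: "(1 - B) * len s (Suc m) < R" "R \<le> (1 - B) * len s m" "A * R \<le> len s (Suc m)"
      using scale_exists[of "1 - B" R s] \<kappa> R RB by blast
    obtain k where k: "1 * len s (Suc k) < r" "r \<le> 1 * len s k" "A * r \<le> len s (Suc k)"
      using scale_exists[of 1 r s] r(1) rR RB \<kappa> by auto
    let ?N = "Suc m" and ?n = "Suc k"
    have "(1 - B) * len s ?n \<le> 1 * len s ?n" using \<kappa> len_pos[of s ?n] by (intro mult_right_mono) auto
    then have k': "(1 - B) * len s ?n < r" using k(1) by linarith
    have lev: "N\<^sub>0 \<le> ?N \<and> real ?N + K * ln (real ?N) \<le> real ?n"
      by (rule sc[OF R r m(3) m(1) k(3) k'])
    have "measure \<mu> (ball x R) / measure \<mu> (ball x r) \<le> mass s ?N / mass s ?n"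
      using measure_ball_le_mass[OF s m(2)] mass_le_measure_ball[OF s, of ?n r] k(1) mass_pos[of s ?n]
      by (intro frac_le) (auto intro: less_imp_le mass_pos)
    also have "\<dots> \<le> (len s ?N / len s ?n) powr \<psi>" using bound lev by blast
    also have "\<dots> \<le> (1 / (A * (1 - B)) * (R / r)) powr \<psi>"
    proof (intro powr_mono2 \<open>\<psi> \<ge> 0\<close>)
      have "len s ?N / len s ?n \<le> (R / (1 - B)) / (A * r)"
        using m(1) k(3) A_pos r(1) \<kappa> R by (intro frac_le) (auto simp: field_simps)
      then show "len s ?N / len s ?n \<le> 1 / (A * (1 - B)) * (R / r)" by (simp add: field_simps)
    qed (use len_pos[of s ?N] len_pos[of s ?n] in simp)
    also have "\<dots> = (1 / (A * (1 - B))) powr \<psi> * (R / r) powr \<psi>"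
      using A_pos \<kappa> R r by (intro powr_mult)
    finally show ?thesis .
  qed
  moreover have "(1 / (A * (1 - B))) powr \<psi> > 0" using A_pos \<kappa> by simp
  ultimately show ?thesis
    unfolding upper_exponent_def using C(1) by (intro exI[of _ C] conjI exI[of _ "(1 / (A * (1 - B))) powr \<psi>"]) auto
qed

lemma lower_exponentI:
  assumes large: "large_dimension_function \<Phi>" and "\<psi> \<ge> 0" and K: "K > 0"
    and bound: "\<And>s N n. N \<ge> N\<^sub>0 \<Longrightarrow> real N + K * ln (real N) \<le> real n \<Longrightarrow>
      (len s N / len s n) powr \<psi> \<le> mass s N / mass s n"
  shows "lower_exponent \<Phi> \<mu> \<psi>"
proof -
  have dim: "dimension_function \<Phi>" using large by (simp add: large_dimension_function_def)
  have \<kappa>: "0 < 1 - B" "1 - B \<le> 1" using B_less_1 B_pos by auto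
  obtain C where C: "0 < C" "C \<le> 1 - B" and sc:
    "\<And>R r s N n. 0 < R \<Longrightarrow> R \<le> C \<Longrightarrow> 0 < r \<Longrightarrow> r < R powr (1 + \<Phi> R) \<Longrightarrow>
       A * R \<le> len s N \<Longrightarrow> (1 - B) * len s N < R \<Longrightarrow> A * r \<le> len s n \<Longrightarrow> (1 - B) * len s n < r \<Longrightarrow>
       N\<^sub>0 \<le> N \<and> real N + K * ln (real N) \<le> real n"
    using large_dimension_function_scales[OF large K, where N\<^sub>0 = N\<^sub>0] by blast
  have "(A * (1 - B)) powr \<psi> * (R / r) powr \<psi> \<le> measure \<mu> (ball x R) / measure \<mu> (ball x r)"
    if x: "x \<in> measure_supp \<mu>" and R: "0 < R" "R \<le> C" and r: "0 < r" "r < R powr (1 + \<Phi> R)" for x r R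
  proof -
    obtain s where s: "\<And>n. x \<in> segment (cyl s n)" using measure_supp_coding[OF x] by blast
    have RB: "R \<le> 1 - B" using R C by simp
    have rR: "r \<le> R" using inner_radius_le_outer_radius[OF R(1) RB r dim] .
    obtain m where m: "1 * len s (Suc m) < R" "R \<le> 1 * len s m" "A * R \<le> len s (Suc m)"
      using scale_exists[of 1 R s] R(1) RB \<kappa> by auto
    obtain k where k: "(1 - B) * len s (Suc k) < r" "r \<le> (1 - B) * len s k" "A * r \<le> len s (Suc k)"
      using scale_exists[of "1 - B" r s] \<kappa> r rR RB by auto
    let ?N = "Suc m" and ?n = "Suc k"
    have "(1 - B) * len s ?N \<le> 1 * len s ?N" using \<kappa> len_pos[of s ?N] by (intro mult_right_mono) auto
    then have m': "(1 - B) * len s ?N < R" using m(1) by linarith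
    have lev: "N\<^sub>0 \<le> ?N \<and> real ?N + K * ln (real ?N) \<le> real ?n"
      by (rule sc[OF R r m(3) m' k(3) k(1)])
    have "(A * (1 - B)) powr \<psi> * (R / r) powr \<psi> = (A * (1 - B) * (R / r)) powr \<psi>"
      using A_pos \<kappa> R r by (intro powr_mult[symmetric])
    also have "\<dots> \<le> (len s ?N / len s ?n) powr \<psi>"
    proof (intro powr_mono2 \<open>\<psi> \<ge> 0\<close>)
      have "(A * R) / (r / (1 - B)) \<le> len s ?N / len s ?n"
        using m(3) k(1) A_pos r(1) \<kappa> R len_pos[of s ?N] len_pos[of s ?n] by (intro frac_le) (auto simp: field_simps)
      then show "A * (1 - B) * (R / r) \<le> len s ?N / len s ?n" by (simp add: field_simps)
    qed (use A_pos \<kappa> R r in simp)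
    also have "\<dots> \<le> mass s ?N / mass s ?n" using bound lev by blast
    also have "\<dots> \<le> measure \<mu> (ball x R) / measure \<mu> (ball x r)"
      using measure_ball_le_mass[OF s k(2)] mass_le_measure_ball[OF s, of ?N R] m(1)
        measure_ball_pos[OF s r(1)]
      by (intro frac_le) (auto intro: less_imp_le mass_pos)
    finally show ?thesis .
  qed
  moreover have "(A * (1 - B)) powr \<psi> > 0" using A_pos \<kappa> by simp
  ultimately show ?thesis
    unfolding lower_exponent_def using C(1) by (intro exI[of _ C] conjI exI[of _ "(A * (1 - B)) powr \<psi>"]) auto
qed

text \<open>
  An upper exponent bounds in particular the measure of small balls around one point from below:
  with \<open>R\<close> fixed and \<open>r \<rightarrow> 0\<close> it says that \<open>r powr d\<close> is at most a constant times the measure of the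
  ball of radius \<open>r\<close>. One point whose mass decays faster refutes it for all dimension functions.
\<close>

lemma not_upper_exponentI:
  assumes dim: "dimension_function \<Phi>" and lim: "(\<lambda>n. mass s n / len s n powr d) \<longlonglongrightarrow> 0"
  shows "\<not> upper_exponent \<Phi> \<mu> d"
proof
  assume "upper_exponent \<Phi> \<mu> d"
  then obtain C1 C2 where C: "C1 > 0" "C2 > 0" and bd: "\<And>x r R. x \<in> measure_supp \<mu> \<Longrightarrow> 0 < R \<Longrightarrow> R < 1 \<Longrightarrow>
     0 < r \<Longrightarrow> r < R powr (1 + \<Phi> R) \<Longrightarrow> R powr (1 + \<Phi> R) \<le> R \<Longrightarrow> R \<le> C1 \<Longrightarrow>
       measure \<mu> (ball x R) / measure \<mu> (ball x r) \<le> C2 * (R / r) powr d"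
    unfolding upper_exponent_def by auto
  define R where "R = min C1 (1/2)"
  have R: "0 < R" "R < 1" "R \<le> C1" using C by (auto simp: R_def)
  obtain x where x: "\<And>n. x \<in> segment (cyl s n)" using exists_point by blast
  have \<kappa>: "0 < 1 - B" using B_less_1 by simp
  have "(\<lambda>n. (1 - B) * len s n) \<longlonglongrightarrow> (1 - B) * 0" by (intro tendsto_intros len_tendsto_0)
  then have "\<forall>\<^sub>F n in sequentially. (1 - B) * len s n < R powr (1 + \<Phi> R)"
    by (rule order_tendstoD) (use R in auto)
  then have "\<forall>\<^sub>F n in sequentially. measure \<mu> (ball x R) \<le> C2 * (R / (1 - B)) powr d * (mass s n / len s n powr d)"
  proof eventually_elim
    case (elim n)
    let ?r = "(1 - B) * len s n"
    have r: "0 < ?r" using \<kappa> len_pos[of s n] by simp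
    have "weight s (Suc n) \<le> 1" using p_pos[of "Suc n"] p_less_1[of "Suc n"] by (auto simp: weight_def branch_def)
    then have "mass s (Suc n) \<le> mass s n" using mass_pos[of s n] by (simp add: mass_Suc mult_left_le_one_le weight_pos less_imp_le)
    then have m: "measure \<mu> (ball x ?r) \<le> mass s n" using measure_ball_le_mass[OF x, of ?r n] by simp
    have "measure \<mu> (ball x R) / measure \<mu> (ball x ?r) \<le> C2 * (R / ?r) powr d"
      by (rule bd[OF mem_measure_supp[OF x] R(1,2) r elim dimension_function_powr_le[OF dim R(1,2)] R(3)])
    then have "measure \<mu> (ball x R) \<le> C2 * (R / ?r) powr d * measure \<mu> (ball x ?r)"
      using measure_ball_pos[OF x r] by (simp add: divide_le_eq)
    also have "\<dots> \<le> C2 * (R / ?r) powr d * mass s n" using m C by (intro mult_left_mono) auto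
    also have "(R / ?r) powr d = (R / (1 - B)) powr d / len s n powr d"
      using R \<kappa> len_pos[of s n] by (simp add: powr_divide powr_mult)
    finally show ?case by (simp add: mult_ac)
  qed
  moreover have "(\<lambda>n. C2 * (R / (1 - B)) powr d * (mass s n / len s n powr d)) \<longlonglongrightarrow> C2 * (R / (1 - B)) powr d * 0"
    by (intro tendsto_mult_left lim)
  ultimately have "measure \<mu> (ball x R) \<le> C2 * (R / (1 - B)) powr d * 0"
    by (intro tendsto_lowerbound) auto
  then show False using measure_ball_pos[OF x R(1)] by simp
qed

text \<open>
  Likewise a lower exponent bounds the measure of small balls around one point from above.
\<close>

lemma not_lower_exponentI:
  assumes dim: "dimension_function \<Phi>" and lim: "filterlim (\<lambda>n. mass s n / len s n powr d) at_top sequentially"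
  shows "\<not> lower_exponent \<Phi> \<mu> d"
proof
  assume "lower_exponent \<Phi> \<mu> d"
  then obtain C1 C2 where C: "C1 > 0" "C2 > 0" and bd: "\<And>x r R. x \<in> measure_supp \<mu> \<Longrightarrow> 0 < R \<Longrightarrow> R < 1 \<Longrightarrow>
     0 < r \<Longrightarrow> r < R powr (1 + \<Phi> R) \<Longrightarrow> R powr (1 + \<Phi> R) \<le> R \<Longrightarrow> R \<le> C1 \<Longrightarrow>
       C2 * (R / r) powr d \<le> measure \<mu> (ball x R) / measure \<mu> (ball x r)"
    unfolding lower_exponent_def by auto
  define R where "R = min C1 (1/2)"
  have R: "0 < R" "R < 1" "R \<le> C1" using C by (auto simp: R_def)
  obtain x where x: "\<And>n. x \<in> segment (cyl s n)" using exists_point by blast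
  have "(\<lambda>n. 2 * len s n) \<longlonglongrightarrow> 2 * 0" by (intro tendsto_intros len_tendsto_0)
  then have "\<forall>\<^sub>F n in sequentially. 2 * len s n < R powr (1 + \<Phi> R)"
    by (rule order_tendstoD) (use R in auto)
  moreover have "\<forall>\<^sub>F n in sequentially. 1 / (C2 * (R / 2) powr d) < mass s n / len s n powr d"
    using lim by (auto simp: filterlim_at_top_dense)
  ultimately have "\<forall>\<^sub>F n::nat in sequentially. False"
  proof eventually_elim
    case (elim n)
    let ?r = "2 * len s n"
    have r: "0 < ?r" using len_pos[of s n] by simp
    have m: "mass s n \<le> measure \<mu> (ball x ?r)" using mass_le_measure_ball[OF x, of n ?r] len_pos[of s n] by simp
    have "C2 * (R / ?r) powr d \<le> measure \<mu> (ball x R) / measure \<mu> (ball x ?r)"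
      by (rule bd[OF mem_measure_supp[OF x] R(1,2) r elim(1) dimension_function_powr_le[OF dim R(1,2)] R(3)])
    also have "\<dots> \<le> 1 / mass s n" using m mass_pos[of s n] by (intro frac_le) auto
    also have "(R / ?r) powr d = (R / 2) powr d / len s n powr d"
      using R len_pos[of s n] by (simp add: powr_divide powr_mult)
    finally have "C2 * (R / 2) powr d * (mass s n / len s n powr d) \<le> 1"
      using mass_pos[of s n] by (simp add: field_simps)
    moreover have "C2 * (R / 2) powr d > 0" using C R by simp
    ultimately show False using elim(2) by (simp add: field_simps)
  qed
  then show False by simp
qed

end

context moran_system
begin

text \<open>
  The contribution of one step to the logarithm of \<open>len powr \<psi> / mass\<close>. Its sums over blocks of steps
  decide how the mass ratio of two nested cylinders compares with the \<open>\<psi>\<close>-th power of their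
  length ratio.
\<close>

definition balance :: "real \<Rightarrow> (nat \<Rightarrow> bool) \<Rightarrow> nat \<Rightarrow> real" where
  "balance \<psi> s i = \<psi> * ln (shrink s i) - ln (weight s i)"

lemma ln_ratio_eq:
  assumes "N \<le> n"
  shows "\<psi> * (ln (len s n) - ln (len s N)) - (ln (mass s n) - ln (mass s N)) = (\<Sum>i\<in>{N<..n}. balance \<psi> s i)"
  unfolding balance_def sum_subtractf sum_distrib_left[symmetric]
  using ln_len_diff[OF assms, of s] ln_mass_diff[OF assms, of s] by simp

lemma ln_quotients:
  "ln (mass s N / mass s n) = ln (mass s N) - ln (mass s n)"
  "ln ((len s N / len s n) powr \<psi>) = \<psi> * (ln (len s N) - ln (len s n))"
  using mass_pos[of s N] mass_pos[of s n] len_pos[of s N] len_pos[of s n]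
  by (simp_all add: ln_divide_pos)

lemma mass_quotient_le:
  assumes "N \<le> n" "(\<Sum>i\<in>{N<..n}. balance \<psi> s i) \<le> 0"
  shows "mass s N / mass s n \<le> (len s N / len s n) powr \<psi>"
proof -
  have "ln (mass s N / mass s n) \<le> ln ((len s N / len s n) powr \<psi>)"
    using assms(2) unfolding ln_ratio_eq[OF assms(1), symmetric] ln_quotients by (simp add: right_diff_distrib)
  moreover have "0 < mass s N / mass s n" "0 < (len s N / len s n) powr \<psi>"
    using mass_pos[of s N] mass_pos[of s n] len_pos[of s N] len_pos[of s n] by simp_all
  ultimately show ?thesis by (simp only: ln_le_cancel_iff)
qed

lemma mass_quotient_ge:
  assumes "N \<le> n" "0 \<le> (\<Sum>i\<in>{N<..n}. balance \<psi> s i)"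
  shows "(len s N / len s n) powr \<psi> \<le> mass s N / mass s n"
proof -
  have "ln ((len s N / len s n) powr \<psi>) \<le> ln (mass s N / mass s n)"
    using assms(2) unfolding ln_ratio_eq[OF assms(1), symmetric] ln_quotients by (simp add: right_diff_distrib)
  moreover have "0 < mass s N / mass s n" "0 < (len s N / len s n) powr \<psi>"
    using mass_pos[of s N] mass_pos[of s n] len_pos[of s N] len_pos[of s n] by simp_all
  ultimately show ?thesis by (simp only: ln_le_cancel_iff)
qed

lemma ln_mass_over_len:
  "ln (mass s n / len s n powr d) = ln (mass s n) - d * ln (len s n)"
  using mass_pos[of s n] len_pos[of s n] by (simp add: ln_div ln_powr)

lemma ln_len_diff_le:
  assumes "N \<le> n" shows "ln (len s n) - ln (len s N) \<le> real (n - N) * ln B"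
proof -
  have "(\<Sum>i\<in>{N<..n}. ln (shrink s i)) \<le> (\<Sum>i\<in>{N<..n}. ln B)"
    using shrink_bounds(2) shrink_pos B_pos by (intro sum_mono) (subst ln_le_cancel_iff, auto)
  then show ?thesis using ln_len_diff[OF assms, of s] by simp
qed

text \<open>
  Replacing \<open>\<psi>\<close> by a smaller \<open>d\<close> gains \<open>(\<psi> - d) * - ln B > 0\<close> in each step. This beats a loss of
  less than \<open>\<epsilon>\<close> per step, so that the quotient decays exponentially.
\<close>

lemma mass_over_len_tendsto_0:
  assumes \<epsilon>: "\<epsilon> < (\<psi> - d) * - ln B" and "d < \<psi>"
    and ev: "\<forall>\<^sub>F n in sequentially. (\<Sum>i\<in>{N<..n}. - \<epsilon> - balance \<psi> s i) \<le> 0"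
  shows "(\<lambda>n. mass s n / len s n powr d) \<longlonglongrightarrow> 0"
proof -
  define c where "c = (\<psi> - d) * - ln B - \<epsilon>"
  have c: "c > 0" using \<epsilon> by (simp add: c_def)
  define E where "E = ln (mass s N) - d * ln (len s N) + c * real N"
  have "\<forall>\<^sub>F n in sequentially. mass s n / len s n powr d \<le> exp (E - c * real n)"
    using ev eventually_ge_at_top[of N]
  proof eventually_elim
    case (elim n)
    have "- (\<Sum>i\<in>{N<..n}. balance \<psi> s i) \<le> real (n - N) * \<epsilon>"
      using elim(1) by (simp add: sum_subtractf)
    moreover have "(\<psi> - d) * (ln (len s n) - ln (len s N)) \<le> (\<psi> - d) * (real (n - N) * ln B)"
      using ln_len_diff_le[OF elim(2), of s] \<open>d < \<psi>\<close> by (intro mult_left_mono) auto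
    moreover have "real (n - N) = real n - real N" using elim(2) by simp
    ultimately have "ln (mass s n) - d * ln (len s n) \<le> E - c * real n"
      using ln_ratio_eq[OF elim(2), of \<psi> s] by (simp add: E_def c_def algebra_simps)
    then have "exp (ln (mass s n / len s n powr d)) \<le> exp (E - c * real n)"
      unfolding ln_mass_over_len by simp
    then show ?case using mass_pos[of s n] len_pos[of s n] by simp
  qed
  moreover have "(\<lambda>n. exp (E - c * real n)) \<longlonglongrightarrow> 0"
  proof (rule filterlim_compose[OF exp_at_bot])
    have "filterlim (\<lambda>n. c * real n) at_top sequentially"
      using c by (intro filterlim_tendsto_pos_mult_at_top[OF tendsto_const] filterlim_real_sequentially)
    then have "filterlim (\<lambda>n. - E + c * real n) at_top sequentially"
      by (rule filterlim_tendsto_add_at_top[OF tendsto_const])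
    then show "filterlim (\<lambda>n. E - c * real n) at_bot sequentially"
      by (simp add: filterlim_uminus_at_bot)
  qed
  ultimately show ?thesis
    by (rule tendsto_sandwich[OF always_eventually _ tendsto_const, rotated])
       (use mass_pos[of s] len_pos[of s] in \<open>auto intro!: divide_nonneg_nonneg intro: less_imp_le\<close>)
qed

lemma mass_over_len_at_top:
  assumes \<epsilon>: "\<epsilon> < (d - \<psi>) * - ln B" and "\<psi> < d"
    and ev: "\<forall>\<^sub>F n in sequentially. (\<Sum>i\<in>{N<..n}. balance \<psi> s i - \<epsilon>) \<le> 0"
  shows "filterlim (\<lambda>n. mass s n / len s n powr d) at_top sequentially"
proof -
  define c where "c = (d - \<psi>) * - ln B - \<epsilon>"
  have c: "c > 0" using \<epsilon> by (simp add: c_def)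
  define E where "E = ln (mass s N) - d * ln (len s N) - c * real N"
  have "\<forall>\<^sub>F n in sequentially. exp (E + c * real n) \<le> mass s n / len s n powr d"
    using ev eventually_ge_at_top[of N]
  proof eventually_elim
    case (elim n)
    have "(\<Sum>i\<in>{N<..n}. balance \<psi> s i) \<le> real (n - N) * \<epsilon>"
      using elim(1) by (simp add: sum_subtractf)
    moreover have "(d - \<psi>) * (ln (len s n) - ln (len s N)) \<le> (d - \<psi>) * (real (n - N) * ln B)"
      using ln_len_diff_le[OF elim(2), of s] \<open>\<psi> < d\<close> by (intro mult_left_mono) auto
    moreover have "real (n - N) = real n - real N" using elim(2) by simp
    ultimately have "E + c * real n \<le> ln (mass s n) - d * ln (len s n)"
      using ln_ratio_eq[OF elim(2), of \<psi> s] by (simp add: E_def c_def algebra_simps)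
    then have "exp (E + c * real n) \<le> exp (ln (mass s n / len s n powr d))"
      unfolding ln_mass_over_len by simp
    then show ?case using mass_pos[of s n] len_pos[of s n] by simp
  qed
  moreover have "filterlim (\<lambda>n. exp (E + c * real n)) at_top sequentially"
  proof (rule filterlim_compose[OF exp_at_top])
    have "filterlim (\<lambda>n. c * real n) at_top sequentially"
      using c by (intro filterlim_tendsto_pos_mult_at_top[OF tendsto_const] filterlim_real_sequentially)
    then show "filterlim (\<lambda>n. E + c * real n) at_top sequentially"
      by (rule filterlim_tendsto_add_at_top[OF tendsto_const])
  qed
  ultimately show ?thesis by (rule filterlim_at_top_mono[rotated])
qed

end

section \<open>The larger and the smaller branch\<close>

text \<open>
  The next two definitions are the larger and the smaller of the balances of the two branches (see
  \<open>max_balance_eq\<close> and \<open>min_balance_eq\<close>), as functions of the triple \<open>(a, b, p)\<close>. They are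
  written with \<open>Y_val\<close> and \<open>Z_val\<close> so that their expectations are visibly given by \<open>G_fun\<close> and
  \<open>G'_fun\<close>.
\<close>

definition max_balance :: "real \<Rightarrow> real \<times> real \<times> real \<Rightarrow> real" where
  "max_balance \<psi> v = \<psi> * Z_val \<psi> (fst v) (fst (snd v)) (snd (snd v)) - Y_val \<psi> (fst v) (fst (snd v)) (snd (snd v))"

definition min_balance :: "real \<Rightarrow> real \<times> real \<times> real \<Rightarrow> real" where
  "min_balance \<psi> v = \<psi> * Z'_val \<psi> (fst v) (fst (snd v)) (snd (snd v)) - Y'_val \<psi> (fst v) (fst (snd v)) (snd (snd v))"

text \<open>
  The threshold \<open>c_val\<close> in the definition of \<open>Y_val\<close> and \<open>Z_val\<close> is where the two branches have equal
  balance: \<open>p \<le> c_val\<close> means \<open>b powr \<psi> / (1 - p) \<le> a powr \<psi> / p\<close>.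
\<close>

lemma le_c_val_iff:
  assumes "0 < a" "0 < b" "0 < p" "p < 1"
  shows "p \<le> c_val \<psi> a b \<longleftrightarrow> \<psi> * ln b - ln (1 - p) \<le> \<psi> * ln a - ln p"
proof -
  have "a powr \<psi> + b powr \<psi> > 0" using assms by (simp add: add_pos_pos)
  then have "p \<le> c_val \<psi> a b \<longleftrightarrow> p * b powr \<psi> \<le> (1 - p) * a powr \<psi>"
    by (simp add: c_val_def pos_le_divide_eq algebra_simps)
  also have "\<dots> \<longleftrightarrow> ln (p * b powr \<psi>) \<le> ln ((1 - p) * a powr \<psi>)"
    using assms by (subst ln_le_cancel_iff) auto
  also have "ln (p * b powr \<psi>) = ln p + \<psi> * ln b"
    using assms by (simp add: ln_mult ln_powr)
  also have "ln ((1 - p) * a powr \<psi>) = ln (1 - p) + \<psi> * ln a"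
    using assms by (simp add: ln_mult ln_powr)
  also have "ln p + \<psi> * ln b \<le> ln (1 - p) + \<psi> * ln a \<longleftrightarrow> \<psi> * ln b - ln (1 - p) \<le> \<psi> * ln a - ln p"
    by linarith
  finally show ?thesis .
qed

lemma max_balance_eq:
  assumes "0 < a" "0 < b" "0 < p" "p < 1"
  shows "max_balance \<psi> (a, b, p) = max (\<psi> * ln a - ln p) (\<psi> * ln b - ln (1 - p))"
proof (cases "p \<le> c_val \<psi> a b")
  case True
  then show ?thesis
    using le_c_val_iff[OF assms, of \<psi>] by (simp add: max_balance_def Y_val_def Z_val_def)
next
  case False
  then show ?thesis
    using le_c_val_iff[OF assms, of \<psi>] by (simp add: max_balance_def Y_val_def Z_val_def)
qed

lemma min_balance_eq:
  assumes "0 < a" "0 < b" "0 < p" "p < 1"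
  shows "min_balance \<psi> (a, b, p) = min (\<psi> * ln a - ln p) (\<psi> * ln b - ln (1 - p))"
proof (cases "p \<le> c_val \<psi> a b")
  case True
  then show ?thesis
    using le_c_val_iff[OF assms, of \<psi>] by (simp add: min_balance_def Y'_val_def Z'_val_def)
next
  case False
  then show ?thesis
    using le_c_val_iff[OF assms, of \<psi>] by (simp add: min_balance_def Y'_val_def Z'_val_def)
qed

lemma borel_measurable_coordinates:
  "(\<lambda>v. fst v) \<in> borel_measurable (borel :: (real \<times> real \<times> real) measure)"
  "(\<lambda>v. fst (snd v)) \<in> borel_measurable (borel :: (real \<times> real \<times> real) measure)"
  "(\<lambda>v. snd (snd v)) \<in> borel_measurable (borel :: (real \<times> real \<times> real) measure)"
  by (intro borel_measurable_continuous_onI continuous_intros)+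

lemma borel_measurable_balance:
  "max_balance \<psi> \<in> borel_measurable borel" "min_balance \<psi> \<in> borel_measurable borel"
  "(\<lambda>v. Z_val \<psi> (fst v) (fst (snd v)) (snd (snd v))) \<in> borel_measurable borel"
  "(\<lambda>v. Z'_val \<psi> (fst v) (fst (snd v)) (snd (snd v))) \<in> borel_measurable borel"
proof -
  note [measurable] = borel_measurable_coordinates
  have [measurable]: "(\<lambda>v :: real \<times> real \<times> real. c_val \<psi> (fst v) (fst (snd v))) \<in> borel_measurable borel"
    unfolding c_val_def
    by (intro borel_measurable_divide powr_real_measurable borel_measurable_add
        borel_measurable_coordinates borel_measurable_const)
  show "max_balance \<psi> \<in> borel_measurable borel"
    unfolding max_balance_def[abs_def] Y_val_def Z_val_def by measurable
  show "min_balance \<psi> \<in> borel_measurable borel"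
    unfolding min_balance_def[abs_def] Y'_val_def Z'_val_def by measurable
  show "(\<lambda>v. Z_val \<psi> (fst v) (fst (snd v)) (snd (snd v))) \<in> borel_measurable borel"
    unfolding Z_val_def by measurable
  show "(\<lambda>v. Z'_val \<psi> (fst v) (fst (snd v)) (snd (snd v))) \<in> borel_measurable borel"
    unfolding Z'_val_def by measurable
qed

section \<open>Random Moran measures\<close>

locale random_moran = prob_space M for M :: "'w measure" +
  fixes a b p :: "nat \<Rightarrow> 'w \<Rightarrow> real" and \<mu> :: "'w \<Rightarrow> real measure" and A B :: real and t :: real
  assumes A_pos: "0 < A" and B_less_1: "B < 1"
    and range: "\<And>n \<omega>. n \<ge> 1 \<Longrightarrow> \<omega> \<in> space M \<Longrightarrow>
          A \<le> a n \<omega> \<and> A \<le> b n \<omega> \<and> a n \<omega> + b n \<omega> \<le> B \<and> 0 \<le> p n \<omega> \<and> p n \<omega> \<le> 1"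
    and indep: "indep_vars (\<lambda>_. borel) (\<lambda>n \<omega>. (a n \<omega>, b n \<omega>, p n \<omega>)) {1..}"
    and ident_distr: "\<And>n. n \<ge> 1 \<Longrightarrow>
          distr M borel (\<lambda>\<omega>. (a n \<omega>, b n \<omega>, p n \<omega>)) = distr M borel (\<lambda>\<omega>. (a 1 \<omega>, b 1 \<omega>, p 1 \<omega>))"
    and t_pos: "t > 0"
    and moments: "\<And>n. n \<ge> 1 \<Longrightarrow> neg_moment M t (p n) < \<infinity>"
      "\<And>n. n \<ge> 1 \<Longrightarrow> neg_moment M t (\<lambda>\<omega>. 1 - p n \<omega>) < \<infinity>"
    and moran: "\<And>\<omega>. \<omega> \<in> space M \<Longrightarrow>
          is_moran_measure (\<lambda>n. a n \<omega>) (\<lambda>n. b n \<omega>) (\<lambda>n. p n \<omega>) (\<mu> \<omega>)"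
begin

definition V :: "nat \<Rightarrow> 'w \<Rightarrow> real \<times> real \<times> real" where "V n \<omega> = (a n \<omega>, b n \<omega>, p n \<omega>)"

lemma V_measurable [measurable]: "n \<ge> 1 \<Longrightarrow> V n \<in> borel_measurable M"
  using indep unfolding indep_vars_def2 V_def[abs_def] by simp

lemma p_measurable: "n \<ge> 1 \<Longrightarrow> p n \<in> borel_measurable M"
  using measurable_compose[OF V_measurable borel_measurable_coordinates(3), of n]
  by (simp add: V_def)

text \<open>
  Here it matters that \<open>neg_moment\<close> is formed in the extended reals, where \<open>1 / 0 = \<infinity>\<close>.
\<close>

lemma neg_moment_finite_imp_AE_pos:
  assumes [measurable]: "q \<in> borel_measurable M" and "neg_moment M t q < \<infinity>"
    and nonneg: "\<And>\<omega>. \<omega> \<in> space M \<Longrightarrow> 0 \<le> q \<omega>"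
  shows "AE \<omega> in M. 0 < q \<omega>"
proof -
  have "AE \<omega> in M. 1 / ennreal (q \<omega> powr t) \<noteq> \<infinity>"
    by (rule nn_integral_PInf_AE) (use assms(2) in \<open>auto simp: neg_moment_def\<close>)
  then show ?thesis
    by (rule AE_mp) (use nonneg in \<open>auto intro!: AE_I2 simp: order_less_le\<close>)
qed

lemma neg_moment_finite_imp_integrable:
  assumes [measurable]: "q \<in> borel_measurable M" and fin: "neg_moment M t q < \<infinity>"
    and nonneg: "\<And>\<omega>. \<omega> \<in> space M \<Longrightarrow> 0 \<le> q \<omega>"
  shows "integrable M (\<lambda>\<omega>. q \<omega> powr (- t))"
proof (rule integrableI_nonneg)
  have "(\<integral>\<^sup>+ \<omega>. ennreal (q \<omega> powr - t) \<partial>M) = neg_moment M t q"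
    unfolding neg_moment_def using neg_moment_finite_imp_AE_pos[OF assms]
    by (intro nn_integral_cong_AE) (auto simp: powr_minus inverse_ennreal divide_ennreal_def elim!: eventually_mono)
  then show "(\<integral>\<^sup>+ \<omega>. ennreal (q \<omega> powr - t) \<partial>M) < \<infinity>" using fin by simp
qed auto

lemma AE_p: "AE \<omega> in M. \<forall>n\<ge>1. 0 < p n \<omega> \<and> p n \<omega> < 1"
proof -
  have "AE \<omega> in M. n \<ge> 1 \<longrightarrow> 0 < p n \<omega> \<and> p n \<omega> < 1" for n
  proof (cases "n \<ge> 1")
    case True
    note [measurable] = p_measurable[OF True]
    have "AE \<omega> in M. 0 < p n \<omega>"
      by (rule neg_moment_finite_imp_AE_pos) (use moments True range in auto)
    moreover have "AE \<omega> in M. 0 < 1 - p n \<omega>"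
      by (rule neg_moment_finite_imp_AE_pos) (use moments True range in auto)
    ultimately show ?thesis by eventually_elim auto
  qed auto
  then show ?thesis by (simp add: AE_all_countable)
qed

lemma AE_moran_system:
  "AE \<omega> in M. moran_system (\<lambda>n. a n \<omega>) (\<lambda>n. b n \<omega>) (\<lambda>n. p n \<omega>) (\<mu> \<omega>) A B"
  using AE_p AE_space
proof eventually_elim
  case (elim \<omega>)
  show ?case
  proof
    fix n :: nat assume n: "1 \<le> n"
    show "A \<le> a n \<omega>" "A \<le> b n \<omega>" "a n \<omega> + b n \<omega> \<le> B" "0 < p n \<omega>" "p n \<omega> < 1"
      using range[OF n elim(2)] elim(1) n by blast+
  qed (rule A_pos B_less_1 moran[OF elim(2)])+
qed

text \<open>
  Both balances are bounded below, because the lengths are at least \<open>A\<close> and \<open>- ln p \<ge> 0\<close>. Their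
  exponential moments at \<open>t\<close> are controlled by the negative moments of \<open>p\<close> and \<open>1 - p\<close>, because
  \<open>a powr \<psi> \<le> 1\<close> and \<open>b powr \<psi> \<le> 1\<close> for \<open>\<psi> \<ge> 0\<close>.
\<close>

lemma balance_bounds:
  assumes "\<psi> \<ge> 0" "n \<ge> 1" "\<omega> \<in> space M" "0 < p n \<omega>" "p n \<omega> < 1"
  shows "\<psi> * ln A \<le> min_balance \<psi> (V n \<omega>)" "min_balance \<psi> (V n \<omega>) \<le> max_balance \<psi> (V n \<omega>)"
    "exp (t * max_balance \<psi> (V n \<omega>)) \<le> p n \<omega> powr (- t) + (1 - p n \<omega>) powr (- t)"
proof -
  have ab: "A \<le> a n \<omega>" "A \<le> b n \<omega>" "0 < a n \<omega>" "0 < b n \<omega>" "a n \<omega> \<le> 1" "b n \<omega> \<le> 1"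
    using range[OF assms(2,3)] A_pos B_less_1 by auto
  have p: "0 < p n \<omega>" "p n \<omega> < 1" "ln (p n \<omega>) \<le> 0" "ln (1 - p n \<omega>) \<le> 0"
    using assms by auto
  have ln: "\<psi> * ln A \<le> \<psi> * ln (a n \<omega>)" "\<psi> * ln A \<le> \<psi> * ln (b n \<omega>)" 
    "\<psi> * ln (a n \<omega>) \<le> 0" "\<psi> * ln (b n \<omega>) \<le> 0"
    using ab A_pos assms(1) by (auto intro!: mult_left_mono mult_nonneg_nonpos)
  show "\<psi> * ln A \<le> min_balance \<psi> (V n \<omega>)"
    unfolding V_def min_balance_eq[OF ab(3,4) p(1,2)] min_le_iff_disj min.bounded_iff using ln p(3,4) by linarith
  show "min_balance \<psi> (V n \<omega>) \<le> max_balance \<psi> (V n \<omega>)"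
    unfolding V_def min_balance_eq[OF ab(3,4) p(1,2)] max_balance_eq[OF ab(3,4) p(1,2)] by auto
  have "t * (\<psi> * ln (a n \<omega>) - ln (p n \<omega>)) \<le> (- t) * ln (p n \<omega>)"
    using mult_nonneg_nonpos[OF less_imp_le[OF t_pos] ln(3)] by (simp add: right_diff_distrib)
  then have 1: "exp (t * (\<psi> * ln (a n \<omega>) - ln (p n \<omega>))) \<le> p n \<omega> powr (- t)"
    using p by (simp add: powr_def)
  have "t * (\<psi> * ln (b n \<omega>) - ln (1 - p n \<omega>)) \<le> (- t) * ln (1 - p n \<omega>)"
    using mult_nonneg_nonpos[OF less_imp_le[OF t_pos] ln(4)] by (simp add: right_diff_distrib)
  then have 2: "exp (t * (\<psi> * ln (b n \<omega>) - ln (1 - p n \<omega>))) \<le> (1 - p n \<omega>) powr (- t)"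
    using p by (simp add: powr_def)
  show "exp (t * max_balance \<psi> (V n \<omega>)) \<le> p n \<omega> powr (- t) + (1 - p n \<omega>) powr (- t)"
    unfolding V_def max_balance_eq[OF ab(3,4) p(1,2)]
    using add_increasing2[OF powr_ge_zero 1] add_increasing[OF powr_ge_zero 2] by (simp add: max_def)
qed

text \<open>
  Integrability and large deviations are the same for the maximum and for the minimum; \<open>g\<close> stands
  for either of them.
\<close>

context
  fixes \<psi> :: real and g :: "real \<times> real \<times> real \<Rightarrow> real"
  assumes \<psi>: "\<psi> \<ge> 0" and g: "g = max_balance \<psi> \<or> g = min_balance \<psi>"
begin

lemma g_measurable: "g \<in> borel_measurable borel"
  using g
proof
  assume eq: "g = max_balance \<psi>"
  show ?thesis unfolding eq by (rule borel_measurable_balance)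
next
  assume eq: "g = min_balance \<psi>"
  show ?thesis unfolding eq by (rule borel_measurable_balance)
qed

lemma g_V_measurable: "(\<lambda>\<omega>. g (V 1 \<omega>)) \<in> borel_measurable M"
  by (rule measurable_compose[OF V_measurable[OF order_refl] g_measurable])

lemma AE_g_bounds: "AE \<omega> in M. \<psi> * ln A \<le> g (V 1 \<omega>) \<and> exp (t * g (V 1 \<omega>)) \<le> p 1 \<omega> powr (- t) + (1 - p 1 \<omega>) powr (- t)"
  using AE_p AE_space
proof eventually_elim
  case (elim \<omega>)
  then have p: "0 < p 1 \<omega>" "p 1 \<omega> < 1" by auto
  note bd = balance_bounds[OF \<psi> order_refl elim(2) p]
  have "exp (t * min_balance \<psi> (V 1 \<omega>)) \<le> exp (t * max_balance \<psi> (V 1 \<omega>))"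
    using bd(2) t_pos by simp
  note min_exp = order_trans[OF this bd(3)]
  from g show ?case
  proof
    assume eq: "g = max_balance \<psi>"
    show ?thesis unfolding eq by (rule conjI[OF order_trans[OF bd(1,2)] bd(3)])
  next
    assume eq: "g = min_balance \<psi>"
    show ?thesis unfolding eq by (rule conjI[OF bd(1) min_exp])
  qed
qed

lemma g_exp_integrable: "integrable M (\<lambda>\<omega>. exp (t * g (V 1 \<omega>)))"
proof (rule Bochner_Integration.integrable_bound)
  show "integrable M (\<lambda>\<omega>. p 1 \<omega> powr (- t) + (1 - p 1 \<omega>) powr (- t))"
    by (intro Bochner_Integration.integrable_add neg_moment_finite_imp_integrable borel_measurable_diff
        borel_measurable_const p_measurable moments order_refl) (use range[OF order_refl] in simp_all)
  show "AE \<omega> in M. norm (exp (t * g (V 1 \<omega>))) \<le> norm (p 1 \<omega> powr (- t) + (1 - p 1 \<omega>) powr (- t))"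
    using AE_g_bounds by eventually_elim auto
  show "(\<lambda>\<omega>. exp (t * g (V 1 \<omega>))) \<in> borel_measurable M"
    by (intro measurable_compose[OF _ borel_measurable_exp] borel_measurable_times g_V_measurable borel_measurable_const)
qed

lemma g_integrable: "integrable M (\<lambda>\<omega>. g (V 1 \<omega>))"
proof (rule Bochner_Integration.integrable_bound)
  show "integrable M (\<lambda>\<omega>. \<bar>\<psi> * ln A\<bar> + exp (t * g (V 1 \<omega>)) / t)"
    using g_exp_integrable by auto
  show "AE \<omega> in M. norm (g (V 1 \<omega>)) \<le> norm (\<bar>\<psi> * ln A\<bar> + exp (t * g (V 1 \<omega>)) / t)"
    using AE_g_bounds
  proof eventually_elim
    case (elim \<omega>)
    have "t * g (V 1 \<omega>) \<le> exp (t * g (V 1 \<omega>))"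
      using exp_ge_add_one_self[of "t * g (V 1 \<omega>)"] by linarith
    then have "g (V 1 \<omega>) \<le> exp (t * g (V 1 \<omega>)) / t" using t_pos by (simp add: field_simps)
    moreover have "0 \<le> exp (t * g (V 1 \<omega>)) / t" using t_pos by simp
    ultimately show ?case using elim by (simp only: real_norm_def) linarith
  qed
qed (rule g_V_measurable)

lemma V_indep: "indep_vars (\<lambda>_. borel) V {1..}"
  using indep by (simp add: V_def[abs_def])

lemma V_ident: "n \<ge> 1 \<Longrightarrow> distr M borel (V n) = distr M borel (V 1)"
  using ident_distr[of n] by (simp add: V_def[abs_def])

lemma block_sums_le:
  assumes "expectation (\<lambda>\<omega>. g (V 1 \<omega>)) < \<epsilon>"
  obtains K where "K > 0"
    "AE \<omega> in M. \<exists>N\<^sub>0. \<forall>N\<ge>N\<^sub>0. \<forall>n. real n \<ge> real N + K * ln (real N) \<longrightarrow> (\<Sum>i\<in>{N<..n}. g (V i \<omega>) - \<epsilon>) \<le> 0"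
proof (rule iid_block_sums_nonpos[OF V_indep V_ident, of "\<lambda>v. g v - \<epsilon>" t])
  have "exp (t * (x - \<epsilon>)) = exp (- t * \<epsilon>) * exp (t * x)" for x
    unfolding mult_exp_exp by (simp add: right_diff_distrib)
  then show "integrable M (\<lambda>\<omega>. exp (t * (g (V 1 \<omega>) - \<epsilon>)))"
    using g_exp_integrable by simp
  show "integrable M (\<lambda>\<omega>. g (V 1 \<omega>) - \<epsilon>)"
    using g_integrable by simp
  show "expectation (\<lambda>\<omega>. g (V 1 \<omega>) - \<epsilon>) < 0"
    using g_integrable assms by (simp add: prob_space)
  show "(\<lambda>v. g v - \<epsilon>) \<in> borel_measurable borel"
    by (intro borel_measurable_diff g_measurable) simp
qed (assumption, rule t_pos, rule that)

text \<open>
  In this direction the summands \<open>\<epsilon> - g\<close> are bounded above, so every positive exponent has a finite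
  moment and \<open>1\<close> is as good as any.
\<close>

lemma block_sums_ge:
  assumes "\<epsilon> < expectation (\<lambda>\<omega>. g (V 1 \<omega>))"
  obtains K where "K > 0"
    "AE \<omega> in M. \<exists>N\<^sub>0. \<forall>N\<ge>N\<^sub>0. \<forall>n. real n \<ge> real N + K * ln (real N) \<longrightarrow> (\<Sum>i\<in>{N<..n}. \<epsilon> - g (V i \<omega>)) \<le> 0"
proof (rule iid_block_sums_nonpos[OF V_indep V_ident, of "\<lambda>v. \<epsilon> - g v" 1])
  show "integrable M (\<lambda>\<omega>. exp (1 * (\<epsilon> - g (V 1 \<omega>))))"
  proof (rule Bochner_Integration.integrable_bound)
    show "integrable M (\<lambda>\<omega>. exp (\<epsilon> - \<psi> * ln A))" by simp
    show "AE \<omega> in M. norm (exp (1 * (\<epsilon> - g (V 1 \<omega>)))) \<le> norm (exp (\<epsilon> - \<psi> * ln A))"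
      using AE_g_bounds by eventually_elim simp
    show "(\<lambda>\<omega>. exp (1 * (\<epsilon> - g (V 1 \<omega>)))) \<in> borel_measurable M"
      by (intro measurable_compose[OF _ borel_measurable_exp] borel_measurable_times borel_measurable_diff g_V_measurable borel_measurable_const)
  qed
  show "integrable M (\<lambda>\<omega>. \<epsilon> - g (V 1 \<omega>))"
    using g_integrable by simp
  show "expectation (\<lambda>\<omega>. \<epsilon> - g (V 1 \<omega>)) < 0"
    using g_integrable assms by (simp add: prob_space)
  show "(\<lambda>v. \<epsilon> - g v) \<in> borel_measurable borel"
    by (intro borel_measurable_diff g_measurable) simp
qed (assumption, simp, rule that)

end

end

section \<open>Almost sure bounds on the dimensions\<close>

context random_moran
begin

text \<open>
  As \<open>E Z\<close> is negative, the sign of the mean balance is that of \<open>E Y / E Z - \<psi>\<close>. This turns the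
  hypotheses on \<open>G_fun\<close> and \<open>G'_fun\<close> into signs of means.
\<close>

lemma expectation_balance:
  fixes Y Z :: "'w \<Rightarrow> real"
  assumes g: "integrable M g" "\<And>\<omega>. \<omega> \<in> space M \<Longrightarrow> g \<omega> = \<psi> * Z \<omega> - Y \<omega>"
    and Z: "Z \<in> borel_measurable M" "\<And>\<omega>. \<omega> \<in> space M \<Longrightarrow> ln A \<le> Z \<omega> \<and> Z \<omega> \<le> ln B"
  shows "expectation Z < 0" "expectation g = expectation Z * (\<psi> - expectation Y / expectation Z)"
proof -
  have "A < B" using range[of 1] A_pos not_empty by fastforce
  then have B: "0 < B" using A_pos by simp
  have intZ: "integrable M Z"
  proof (rule integrable_const_bound[of _ "\<bar>ln A\<bar> + \<bar>ln B\<bar>"])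
    show "AE \<omega> in M. norm (Z \<omega>) \<le> \<bar>ln A\<bar> + \<bar>ln B\<bar>"
    proof (rule AE_I2)
      fix \<omega> assume "\<omega> \<in> space M"
      from Z(2)[OF this] show "norm (Z \<omega>) \<le> \<bar>ln A\<bar> + \<bar>ln B\<bar>" unfolding real_norm_def by linarith
    qed
  qed (rule Z(1))
  have "expectation Z \<le> expectation (\<lambda>_. ln B)"
    by (rule integral_mono) (use intZ Z in auto)
  also have "\<dots> < 0" using B B_less_1 by (simp add: prob_space)
  finally show neg: "expectation Z < 0" .
  have "expectation Y = expectation (\<lambda>\<omega>. \<psi> * Z \<omega> - g \<omega>)"
    by (rule Bochner_Integration.integral_cong) (simp_all add: g(2))
  also have "\<dots> = \<psi> * expectation Z - expectation g"
    using intZ g(1) by simp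
  finally have "expectation g = expectation Z * \<psi> - expectation Y" by simp
  moreover have "expectation Z * (\<psi> - expectation Y / expectation Z) = expectation Z * \<psi> - expectation Y"
    using neg by (simp add: right_diff_distrib)
  ultimately show "expectation g = expectation Z * (\<psi> - expectation Y / expectation Z)" by simp
qed

lemma V_coordinates: "fst (V n \<omega>) = a n \<omega>" "fst (snd (V n \<omega>)) = b n \<omega>" "snd (snd (V n \<omega>)) = p n \<omega>"
  by (simp_all add: V_def)

lemma ln_bounds:
  assumes "n \<ge> 1" "\<omega> \<in> space M"
  shows "ln A \<le> ln (a n \<omega>)" "ln (a n \<omega>) \<le> ln B" "ln A \<le> ln (b n \<omega>)" "ln (b n \<omega>) \<le> ln B"
  using range[OF assms] A_pos by (auto intro!: ln_mono)

lemma expectation_max_balance: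
  assumes "\<psi> \<ge> 0"
  obtains z where "z < 0" "expectation (\<lambda>\<omega>. max_balance \<psi> (V 1 \<omega>)) = z * (\<psi> - G_fun M a b p \<psi>)"
proof -
  have int: "integrable M (\<lambda>\<omega>. max_balance \<psi> (V 1 \<omega>))"
    by (rule g_integrable[OF assms]) simp
  have Z: "(\<lambda>\<omega>. Z_val \<psi> (a 1 \<omega>) (b 1 \<omega>) (p 1 \<omega>)) \<in> borel_measurable M"
    using measurable_compose[OF V_measurable[OF order_refl] borel_measurable_balance(3)]
    unfolding V_coordinates .
  have eq: "max_balance \<psi> (V 1 \<omega>) = \<psi> * Z_val \<psi> (a 1 \<omega>) (b 1 \<omega>) (p 1 \<omega>) - Y_val \<psi> (a 1 \<omega>) (b 1 \<omega>) (p 1 \<omega>)" for \<omega>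
    unfolding max_balance_def V_coordinates ..
  have bd: "ln A \<le> Z_val \<psi> (a 1 \<omega>) (b 1 \<omega>) (p 1 \<omega>) \<and> Z_val \<psi> (a 1 \<omega>) (b 1 \<omega>) (p 1 \<omega>) \<le> ln B" if "\<omega> \<in> space M" for \<omega>
    unfolding Z_val_def using ln_bounds[OF order_refl that] by presburger
  show thesis
    by (rule that[OF expectation_balance[OF int eq Z bd, folded G_fun_def]])
qed

lemma expectation_min_balance:
  assumes "\<psi> \<ge> 0"
  obtains z where "z < 0" "expectation (\<lambda>\<omega>. min_balance \<psi> (V 1 \<omega>)) = z * (\<psi> - G'_fun M a b p \<psi>)"
proof -
  have int: "integrable M (\<lambda>\<omega>. min_balance \<psi> (V 1 \<omega>))"
    by (rule g_integrable[OF assms]) simp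
  have Z: "(\<lambda>\<omega>. Z'_val \<psi> (a 1 \<omega>) (b 1 \<omega>) (p 1 \<omega>)) \<in> borel_measurable M"
    using measurable_compose[OF V_measurable[OF order_refl] borel_measurable_balance(4)]
    unfolding V_coordinates .
  have eq: "min_balance \<psi> (V 1 \<omega>) = \<psi> * Z'_val \<psi> (a 1 \<omega>) (b 1 \<omega>) (p 1 \<omega>) - Y'_val \<psi> (a 1 \<omega>) (b 1 \<omega>) (p 1 \<omega>)" for \<omega>
    unfolding min_balance_def V_coordinates ..
  have bd: "ln A \<le> Z'_val \<psi> (a 1 \<omega>) (b 1 \<omega>) (p 1 \<omega>) \<and> Z'_val \<psi> (a 1 \<omega>) (b 1 \<omega>) (p 1 \<omega>) \<le> ln B" if "\<omega> \<in> space M" for \<omega>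
    unfolding Z'_val_def using ln_bounds[OF order_refl that] by presburger
  show thesis
    by (rule that[OF expectation_balance[OF int eq Z bd, folded G'_fun_def]])
qed

text \<open>
  Every word has balances between the minimum and the maximum, and both extremes are attained: by
  the word that always follows the branch selected by \<open>c_val\<close>, and by the opposite word.
\<close>

lemma balance_along_words:
  fixes \<psi> :: real
  assumes S: "moran_system (\<lambda>n. a n \<omega>) (\<lambda>n. b n \<omega>) (\<lambda>n. p n \<omega>) (\<mu> \<omega>) A B" and i: "i \<ge> 1"
  defines "bal \<equiv> moran_system.balance (\<lambda>n. a n \<omega>) (\<lambda>n. b n \<omega>) (\<lambda>n. p n \<omega>)"
    and "left \<equiv> \<lambda>n. p n \<omega> \<le> c_val \<psi> (a n \<omega>) (b n \<omega>)"
  shows "min_balance \<psi> (V i \<omega>) \<le> bal \<psi> s i" "bal \<psi> s i \<le> max_balance \<psi> (V i \<omega>)"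
    "bal \<psi> left i = max_balance \<psi> (V i \<omega>)" "bal \<psi> (\<lambda>n. \<not> left n) i = min_balance \<psi> (V i \<omega>)"
proof -
  interpret S: moran_system "\<lambda>n. a n \<omega>" "\<lambda>n. b n \<omega>" "\<lambda>n. p n \<omega>" "\<mu> \<omega>" A B by (rule S)
  have pos: "0 < a i \<omega>" "0 < b i \<omega>" "0 < p i \<omega>" "p i \<omega> < 1"
    using S.a_ge[OF i] S.b_ge[OF i] S.p_pos[OF i] S.p_less_1[OF i] A_pos by linarith+
  have bal: "bal \<psi> s i = (if s i then \<psi> * ln (a i \<omega>) - ln (p i \<omega>) else \<psi> * ln (b i \<omega>) - ln (1 - p i \<omega>))" for s
    by (simp add: bal_def S.balance_def S.shrink_def S.weight_def branch_def)
  show "min_balance \<psi> (V i \<omega>) \<le> bal \<psi> s i" "bal \<psi> s i \<le> max_balance \<psi> (V i \<omega>)"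
    unfolding bal V_def max_balance_eq[OF pos] min_balance_eq[OF pos] by auto
  show "bal \<psi> left i = max_balance \<psi> (V i \<omega>)" "bal \<psi> (\<lambda>n. \<not> left n) i = min_balance \<psi> (V i \<omega>)"
    unfolding bal V_def max_balance_def min_balance_def left_def
    by (simp_all add: Y_val_def Z_val_def Y'_val_def Z'_val_def)
qed

text \<open>
  If the mean of the maximal balance is negative, then almost surely all late and logarithmically
  long blocks have nonpositive sums for the worst choice of branches, and hence for every word at
  the same time. This uniformity over words is why no union bound over the \<open>2 ^ n\<close> cylinders of a
  step is required.
\<close>

lemma AE_upper_dim_le:
  assumes \<psi>: "\<psi> \<ge> 0" and G: "G_fun M a b p \<psi> < \<psi>"
  shows "AE \<omega> in M. \<forall>\<Phi>. large_dimension_function \<Phi> \<longrightarrow> upper_dim \<Phi> (\<mu> \<omega>) \<le> ereal \<psi>"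
proof -
  obtain z where "z < 0" "expectation (\<lambda>\<omega>. max_balance \<psi> (V 1 \<omega>)) = z * (\<psi> - G_fun M a b p \<psi>)"
    using expectation_max_balance[OF \<psi>] by blast
  then have "expectation (\<lambda>\<omega>. max_balance \<psi> (V 1 \<omega>)) < 0"
    using G by (simp add: mult_neg_pos)
  then obtain K where K: "K > 0" and ae: "AE \<omega> in M. \<exists>N\<^sub>0. \<forall>N\<ge>N\<^sub>0. \<forall>n. real n \<ge> real N + K * ln (real N) \<longrightarrow>
      (\<Sum>i\<in>{N<..n}. max_balance \<psi> (V i \<omega>) - 0) \<le> 0"
    using block_sums_le[OF \<psi>, of "max_balance \<psi>" 0] by blast
  from ae AE_moran_system show ?thesis
  proof eventually_elim
    case (elim \<omega>)
    interpret S: moran_system "\<lambda>n. a n \<omega>" "\<lambda>n. b n \<omega>" "\<lambda>n. p n \<omega>" "\<mu> \<omega>" A B by (rule elim(2))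
    obtain N\<^sub>0 where N0: "\<And>N n. N \<ge> N\<^sub>0 \<Longrightarrow> real n \<ge> real N + K * ln (real N) \<Longrightarrow>
      (\<Sum>i\<in>{N<..n}. max_balance \<psi> (V i \<omega>)) \<le> 0" using elim(1) by (auto simp only: diff_0_right)
    show ?case
    proof (intro allI impI)
      fix \<Phi> assume large: "large_dimension_function \<Phi>"
      have "upper_exponent \<Phi> (\<mu> \<omega>) \<psi>"
      proof (rule S.upper_exponentI[OF large \<psi> K, of N\<^sub>0])
        fix s N n assume Nn: "N\<^sub>0 \<le> N" "real N + K * ln (real N) \<le> real n"
        have "0 \<le> K * ln (real N)" using K by (cases "N = 0") simp_all
        then have "N \<le> n" using Nn(2) by linarith
        moreover have "(\<Sum>i\<in>{N<..n}. S.balance \<psi> s i) \<le> (\<Sum>i\<in>{N<..n}. max_balance \<psi> (V i \<omega>))"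
          by (intro sum_mono balance_along_words(2)[OF elim(2)]) simp
        ultimately show "S.mass s N / S.mass s n \<le> (S.len s N / S.len s n) powr \<psi>"
          using N0[OF Nn] by (intro S.mass_quotient_le) linarith+
      qed
      then show "upper_dim \<Phi> (\<mu> \<omega>) \<le> ereal \<psi>"
        unfolding upper_dim_eq by (intro Inf_lower) blast
    qed
  qed
qed

lemma AE_lower_dim_ge:
  assumes \<psi>: "\<psi> \<ge> 0" and G': "G'_fun M a b p \<psi> > \<psi>"
  shows "AE \<omega> in M. \<forall>\<Phi>. large_dimension_function \<Phi> \<longrightarrow> lower_dim \<Phi> (\<mu> \<omega>) \<ge> ereal \<psi>"
proof -
  obtain z where "z < 0" "expectation (\<lambda>\<omega>. min_balance \<psi> (V 1 \<omega>)) = z * (\<psi> - G'_fun M a b p \<psi>)"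
    using expectation_min_balance[OF \<psi>] by blast
  then have "0 < expectation (\<lambda>\<omega>. min_balance \<psi> (V 1 \<omega>))"
    using G' by (simp add: mult_neg_neg)
  then obtain K where K: "K > 0" and ae: "AE \<omega> in M. \<exists>N\<^sub>0. \<forall>N\<ge>N\<^sub>0. \<forall>n. real n \<ge> real N + K * ln (real N) \<longrightarrow>
      (\<Sum>i\<in>{N<..n}. 0 - min_balance \<psi> (V i \<omega>)) \<le> 0"
    using block_sums_ge[OF \<psi>, of "min_balance \<psi>" 0] by blast
  from ae AE_moran_system show ?thesis
  proof eventually_elim
    case (elim \<omega>)
    interpret S: moran_system "\<lambda>n. a n \<omega>" "\<lambda>n. b n \<omega>" "\<lambda>n. p n \<omega>" "\<mu> \<omega>" A B by (rule elim(2))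
    obtain N\<^sub>0 where N0: "\<And>N n. N \<ge> N\<^sub>0 \<Longrightarrow> real n \<ge> real N + K * ln (real N) \<Longrightarrow>
      0 \<le> (\<Sum>i\<in>{N<..n}. min_balance \<psi> (V i \<omega>))" 
      using elim(1) by (auto simp only: diff_0 sum_negf neg_le_0_iff_le)
    show ?case
    proof (intro allI impI)
      fix \<Phi> assume large: "large_dimension_function \<Phi>"
      have "lower_exponent \<Phi> (\<mu> \<omega>) \<psi>"
      proof (rule S.lower_exponentI[OF large \<psi> K, of N\<^sub>0])
        fix s N n assume Nn: "N\<^sub>0 \<le> N" "real N + K * ln (real N) \<le> real n"
        have "0 \<le> K * ln (real N)" using K by (cases "N = 0") simp_all
        then have "N \<le> n" using Nn(2) by linarith
        moreover have "(\<Sum>i\<in>{N<..n}. min_balance \<psi> (V i \<omega>)) \<le> (\<Sum>i\<in>{N<..n}. S.balance \<psi> s i)"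
          by (intro sum_mono balance_along_words(1)[OF elim(2)]) simp
        ultimately show "(S.len s N / S.len s n) powr \<psi> \<le> S.mass s N / S.mass s n"
          using N0[OF Nn] by (intro S.mass_quotient_ge) linarith+
      qed
      then show "ereal \<psi> \<le> lower_dim \<Phi> (\<mu> \<omega>)"
        unfolding lower_dim_eq by (intro Sup_upper) blast
    qed
  qed
qed

text \<open>
  Here the word with the maximal balances defines a single bad point. The mean may be \<open>0\<close>, so the sums
  are only known to be at least \<open>- \<epsilon>\<close> per step for each \<open>\<epsilon> > 0\<close>; this excludes every \<open>d < \<psi>\<close>. Taking
  \<open>\<epsilon> = 1 / (k + 1)\<close> keeps the exceptional set independent of \<open>d\<close>.
\<close>

lemma AE_upper_dim_ge:
  assumes \<psi>: "\<psi> \<ge> 0" and G: "G_fun M a b p \<psi> \<ge> \<psi>"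
  shows "AE \<omega> in M. \<forall>\<Phi>. large_dimension_function \<Phi> \<longrightarrow> upper_dim \<Phi> (\<mu> \<omega>) \<ge> ereal \<psi>"
proof -
  obtain z where "z < 0" "expectation (\<lambda>\<omega>. max_balance \<psi> (V 1 \<omega>)) = z * (\<psi> - G_fun M a b p \<psi>)"
    using expectation_max_balance[OF \<psi>] by blast
  then have E: "0 \<le> expectation (\<lambda>\<omega>. max_balance \<psi> (V 1 \<omega>))"
    using G by (simp add: mult_nonpos_nonpos)
  have "AE \<omega> in M. \<exists>K N\<^sub>0. \<forall>N\<ge>N\<^sub>0. \<forall>n. real n \<ge> real N + K * ln (real N) \<longrightarrow>
      (\<Sum>i\<in>{N<..n}. - (1 / real (Suc k)) - max_balance \<psi> (V i \<omega>)) \<le> 0" for k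
  proof -
    have "- (1 / real (Suc k)) < 0" by simp
    then have "- (1 / real (Suc k)) < expectation (\<lambda>\<omega>. max_balance \<psi> (V 1 \<omega>))" using E by linarith
    then obtain K where "AE \<omega> in M. \<exists>N\<^sub>0. \<forall>N\<ge>N\<^sub>0. \<forall>n. real n \<ge> real N + K * ln (real N) \<longrightarrow>
      (\<Sum>i\<in>{N<..n}. - (1 / real (Suc k)) - max_balance \<psi> (V i \<omega>)) \<le> 0"
      using block_sums_ge[OF \<psi>, of "max_balance \<psi>" "- (1 / real (Suc k))"] by blast
    then show ?thesis by (rule eventually_mono) blast
  qed
  then have ae: "AE \<omega> in M. \<forall>k. \<exists>K N\<^sub>0. \<forall>N\<ge>N\<^sub>0. \<forall>n. real n \<ge> real N + K * ln (real N) \<longrightarrow>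
      (\<Sum>i\<in>{N<..n}. - (1 / real (Suc k)) - max_balance \<psi> (V i \<omega>)) \<le> 0"
    unfolding AE_all_countable by blast
  from ae AE_moran_system show ?thesis
  proof eventually_elim
    case (elim \<omega>)
    interpret S: moran_system "\<lambda>n. a n \<omega>" "\<lambda>n. b n \<omega>" "\<lambda>n. p n \<omega>" "\<mu> \<omega>" A B by (rule elim(2))
    define s where "s n \<longleftrightarrow> p n \<omega> \<le> c_val \<psi> (a n \<omega>) (b n \<omega>)" for n
    have bal: "S.balance \<psi> s i = max_balance \<psi> (V i \<omega>)" if "i \<ge> 1" for i
      using balance_along_words(3)[OF elim(2) that, of \<psi>] unfolding s_def .
    show ?case
    proof (intro allI impI)
      fix \<Phi> assume "large_dimension_function \<Phi>"
      then have dim: "dimension_function \<Phi>" by (simp add: large_dimension_function_def)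
      have "\<psi> \<le> d" if d: "upper_exponent \<Phi> (\<mu> \<omega>) d" for d
      proof (rule ccontr)
        assume "\<not> \<psi> \<le> d"
        then have less: "d < \<psi>" by simp
        have "0 < (\<psi> - d) * - ln B" using less S.B_pos B_less_1 by (intro mult_pos_pos) simp_all
        then obtain k where k: "1 / real (Suc k) < (\<psi> - d) * - ln B" by (rule small_inverse_Suc)
        obtain K where "\<exists>N\<^sub>0. \<forall>N\<ge>N\<^sub>0. \<forall>n. real n \<ge> real N + K * ln (real N) \<longrightarrow>
          (\<Sum>i\<in>{N<..n}. - (1 / real (Suc k)) - max_balance \<psi> (V i \<omega>)) \<le> 0" using elim(1) by blast
        then obtain N where "\<forall>\<^sub>F n in sequentially. (\<Sum>i\<in>{N<..n}. - (1 / real (Suc k)) - max_balance \<psi> (V i \<omega>)) \<le> 0"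
          by (rule eventually_of_block_sums[where f = "\<lambda>i. - (1 / real (Suc k)) - max_balance \<psi> (V i \<omega>)"])
        then have "\<forall>\<^sub>F n in sequentially. (\<Sum>i\<in>{N<..n}. - (1 / real (Suc k)) - S.balance \<psi> s i) \<le> 0"
          by (rule eventually_mono) (simp add: bal)
        from S.not_upper_exponentI[OF dim S.mass_over_len_tendsto_0[OF k less this]] d
        show False by contradiction
      qed
      then show "ereal \<psi> \<le> upper_dim \<Phi> (\<mu> \<omega>)"
        unfolding upper_dim_eq by (intro Inf_greatest) auto
    qed
  qed
qed

lemma AE_lower_dim_le:
  assumes \<psi>: "\<psi> \<ge> 0" and G': "G'_fun M a b p \<psi> \<le> \<psi>"
  shows "AE \<omega> in M. \<forall>\<Phi>. large_dimension_function \<Phi> \<longrightarrow> lower_dim \<Phi> (\<mu> \<omega>) \<le> ereal \<psi>"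
proof -
  obtain z where "z < 0" "expectation (\<lambda>\<omega>. min_balance \<psi> (V 1 \<omega>)) = z * (\<psi> - G'_fun M a b p \<psi>)"
    using expectation_min_balance[OF \<psi>] by blast
  then have E: "expectation (\<lambda>\<omega>. min_balance \<psi> (V 1 \<omega>)) \<le> 0"
    using G' by (simp add: mult_nonpos_nonneg)
  have "AE \<omega> in M. \<exists>K N\<^sub>0. \<forall>N\<ge>N\<^sub>0. \<forall>n. real n \<ge> real N + K * ln (real N) \<longrightarrow>
      (\<Sum>i\<in>{N<..n}. min_balance \<psi> (V i \<omega>) - 1 / real (Suc k)) \<le> 0" for k
  proof -
    have "0 < 1 / real (Suc k)" by simp
    then have "expectation (\<lambda>\<omega>. min_balance \<psi> (V 1 \<omega>)) < 1 / real (Suc k)" using E by linarith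
    then obtain K where "AE \<omega> in M. \<exists>N\<^sub>0. \<forall>N\<ge>N\<^sub>0. \<forall>n. real n \<ge> real N + K * ln (real N) \<longrightarrow>
      (\<Sum>i\<in>{N<..n}. min_balance \<psi> (V i \<omega>) - 1 / real (Suc k)) \<le> 0"
      using block_sums_le[OF \<psi>, of "min_balance \<psi>" "1 / real (Suc k)"] by blast
    then show ?thesis by (rule eventually_mono) blast
  qed
  then have ae: "AE \<omega> in M. \<forall>k. \<exists>K N\<^sub>0. \<forall>N\<ge>N\<^sub>0. \<forall>n. real n \<ge> real N + K * ln (real N) \<longrightarrow>
      (\<Sum>i\<in>{N<..n}. min_balance \<psi> (V i \<omega>) - 1 / real (Suc k)) \<le> 0"
    unfolding AE_all_countable by blast
  from ae AE_moran_system show ?thesis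
  proof eventually_elim
    case (elim \<omega>)
    interpret S: moran_system "\<lambda>n. a n \<omega>" "\<lambda>n. b n \<omega>" "\<lambda>n. p n \<omega>" "\<mu> \<omega>" A B by (rule elim(2))
    define s where "s n \<longleftrightarrow> \<not> p n \<omega> \<le> c_val \<psi> (a n \<omega>) (b n \<omega>)" for n
    have bal: "S.balance \<psi> s i = min_balance \<psi> (V i \<omega>)" if "i \<ge> 1" for i
      using balance_along_words(4)[OF elim(2) that, of \<psi>] unfolding s_def .
    show ?case
    proof (intro allI impI)
      fix \<Phi> assume "large_dimension_function \<Phi>"
      then have dim: "dimension_function \<Phi>" by (simp add: large_dimension_function_def)
      have "d \<le> \<psi>" if d: "lower_exponent \<Phi> (\<mu> \<omega>) d" for d
      proof (rule ccontr)
        assume "\<not> d \<le> \<psi>"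
        then have less: "\<psi> < d" by simp
        have "0 < (d - \<psi>) * - ln B" using less S.B_pos B_less_1 by (intro mult_pos_pos) simp_all
        then obtain k where k: "1 / real (Suc k) < (d - \<psi>) * - ln B" by (rule small_inverse_Suc)
        obtain K where "\<exists>N\<^sub>0. \<forall>N\<ge>N\<^sub>0. \<forall>n. real n \<ge> real N + K * ln (real N) \<longrightarrow>
          (\<Sum>i\<in>{N<..n}. min_balance \<psi> (V i \<omega>) - 1 / real (Suc k)) \<le> 0" using elim(1) by blast
        then obtain N where "\<forall>\<^sub>F n in sequentially. (\<Sum>i\<in>{N<..n}. min_balance \<psi> (V i \<omega>) - 1 / real (Suc k)) \<le> 0"
          by (rule eventually_of_block_sums[where f = "\<lambda>i. min_balance \<psi> (V i \<omega>) - 1 / real (Suc k)"])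
        then have "\<forall>\<^sub>F n in sequentially. (\<Sum>i\<in>{N<..n}. S.balance \<psi> s i - 1 / real (Suc k)) \<le> 0"
          by (rule eventually_mono) (simp add: bal)
        from S.not_lower_exponentI[OF dim S.mass_over_len_at_top[OF k less this]] d
        show False by contradiction
      qed
      then show "lower_dim \<Phi> (\<mu> \<omega>) \<le> ereal \<psi>"
        unfolding lower_dim_eq by (intro Sup_least) auto
    qed
  qed
qed

lemma AE_imp_full_measure_set:
  assumes "AE \<omega> in M. \<forall>\<Phi>. L \<Phi> \<longrightarrow> P \<Phi> \<omega>"
  shows "\<exists>\<Gamma>\<in>sets M. measure M \<Gamma> = 1 \<and> (\<forall>\<Phi>. L \<Phi> \<longrightarrow> (\<forall>\<omega>\<in>\<Gamma>. P \<Phi> \<omega>))"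
proof -
  obtain S where S: "S \<subseteq> {\<omega> \<in> space M. \<forall>\<Phi>. L \<Phi> \<longrightarrow> P \<Phi> \<omega>}" "S \<in> events" "prob S = 1"
    using AE_E_prob[OF assms] .
  show ?thesis
    using S by (intro bexI[of _ S] conjI allI impI ballI) auto
qed

end

theorem theorem1:
  fixes M :: "'w measure"
    and A B \<psi> :: real
    and a b p :: "nat \<Rightarrow> 'w \<Rightarrow> real"
    and \<mu> :: "'w \<Rightarrow> real measure"
  assumes "prob_space M"
    and "0 < 2 * A" "2 * A \<le> B" "B < 1"
    and range: "\<And>n \<omega>. n \<ge> 1 \<Longrightarrow> \<omega> \<in> space M \<Longrightarrow>
          a n \<omega> \<in> {0..1} \<and> b n \<omega> \<in> {0..1} \<and> p n \<omega> \<in> {0..1} \<and>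
          A \<le> min (a n \<omega>) (b n \<omega>) \<and> min (a n \<omega>) (b n \<omega>) < a n \<omega> + b n \<omega> \<and> a n \<omega> + b n \<omega> \<le> B"
    and indep: "prob_space.indep_vars M (\<lambda>_. borel) (\<lambda>n \<omega>. (a n \<omega>, b n \<omega>, p n \<omega>)) {1..}"
    and ident_distr: "\<And>n. n \<ge> 1 \<Longrightarrow>
          distr M borel (\<lambda>\<omega>. (a n \<omega>, b n \<omega>, p n \<omega>)) = distr M borel (\<lambda>\<omega>. (a 1 \<omega>, b 1 \<omega>, p 1 \<omega>))"
    and moments: "\<exists>t>0. \<forall>n\<ge>1. neg_moment M t (p n) < \<infinity> \<and> neg_moment M t (\<lambda>\<omega>. 1 - p n \<omega>) < \<infinity>"
    and moran: "\<And>\<omega>. \<omega> \<in> space M \<Longrightarrow>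
          is_moran_measure (\<lambda>n. a n \<omega>) (\<lambda>n. b n \<omega>) (\<lambda>n. p n \<omega>) (\<mu> \<omega>)"
    and "\<psi> \<ge> 0"
  shows "(G_fun M a b p \<psi> < \<psi> \<longrightarrow>
            (\<exists>\<Gamma>\<in>sets M. measure M \<Gamma> = 1 \<and>
              (\<forall>\<Phi>. large_dimension_function \<Phi> \<longrightarrow> (\<forall>\<omega>\<in>\<Gamma>. upper_dim \<Phi> (\<mu> \<omega>) \<le> ereal \<psi>)))) \<and>
         (G_fun M a b p \<psi> \<ge> \<psi> \<longrightarrow>
            (\<exists>\<Gamma>\<in>sets M. measure M \<Gamma> = 1 \<and>
              (\<forall>\<Phi>. large_dimension_function \<Phi> \<longrightarrow> (\<forall>\<omega>\<in>\<Gamma>. upper_dim \<Phi> (\<mu> \<omega>) \<ge> ereal \<psi>)))) \<and>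
         (G'_fun M a b p \<psi> > \<psi> \<longrightarrow>
            (\<exists>\<Gamma>\<in>sets M. measure M \<Gamma> = 1 \<and>
              (\<forall>\<Phi>. large_dimension_function \<Phi> \<longrightarrow> (\<forall>\<omega>\<in>\<Gamma>. lower_dim \<Phi> (\<mu> \<omega>) \<ge> ereal \<psi>)))) \<and>
         (G'_fun M a b p \<psi> \<le> \<psi> \<longrightarrow>
            (\<exists>\<Gamma>\<in>sets M. measure M \<Gamma> = 1 \<and>
              (\<forall>\<Phi>. large_dimension_function \<Phi> \<longrightarrow> (\<forall>\<omega>\<in>\<Gamma>. lower_dim \<Phi> (\<mu> \<omega>) \<le> ereal \<psi>))))"
proof -
  interpret prob_space M by fact
  obtain t where t: "t > 0" and mom: "\<And>n. n \<ge> 1 \<Longrightarrow> neg_moment M t (p n) < \<infinity>"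
      "\<And>n. n \<ge> 1 \<Longrightarrow> neg_moment M t (\<lambda>\<omega>. 1 - p n \<omega>) < \<infinity>"
    using moments by blast
  have A: "0 < A" using \<open>0 < 2 * A\<close> by simp
  have bounds: "A \<le> a n \<omega> \<and> A \<le> b n \<omega> \<and> a n \<omega> + b n \<omega> \<le> B \<and> 0 \<le> p n \<omega> \<and> p n \<omega> \<le> 1"
    if "n \<ge> 1" "\<omega> \<in> space M" for n \<omega>
    using range[OF that] by simp
  interpret random_moran M a b p \<mu> A B t
    by (unfold_locales; fact A \<open>B < 1\<close> bounds indep ident_distr t mom moran)
  show ?thesis
    using AE_imp_full_measure_set[OF AE_upper_dim_le[OF \<open>\<psi> \<ge> 0\<close>]]
      AE_imp_full_measure_set[OF AE_upper_dim_ge[OF \<open>\<psi> \<ge> 0\<close>]]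
      AE_imp_full_measure_set[OF AE_lower_dim_ge[OF \<open>\<psi> \<ge> 0\<close>]]
      AE_imp_full_measure_set[OF AE_lower_dim_le[OF \<open>\<psi> \<ge> 0\<close>]]
    by (intro conjI impI)
qed

end
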